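(* Let $n,k$ be integers with $2\leq k\leq n-4$, and let $G$ be a connected graph of order $n$ (so $n\geq k+4$) with minimum degree $\delta\geq k+1$. If $$RDD(G)\geq n^{3}-7n^{2}+(20+4k)n+k^{2}-4k-17,$$ then $G$ is $k$-leaf-connected unless $G$ is (isomorphic to) a member of $\{K_{3}\vee(K_{n-5}+2K_{1}),\ K_{4}\vee4K_{1},\ K_{3}\vee (K_{1,3}+K_{1}),\ K_{4}\vee(K_{2}+3K_{1}),\ K_{5}\vee5K_{1}\}$.
   Context: All graphs are finite, simple and undirected; the order of $G$ is $|V(G)|$. $d_G(v)$ is the degree of the vertex $v$ in $G$, $\delta=\delta(G)$ is the minimum degree, and $d_G(u,v)$ is the distance between $u$ and $v$, i.e. the length of a shortest path from $u$ to $v$. The reciprocal degree distance of a connected graph $G$ is $$RDD(G)=\sum_{\{u,v\}\subseteq V(G),\,u\neq v}\frac{d_{G}(u)+d_{G}(v)}{d_{G}(u,v)},$$ the sum being over unordered pairs of distinct vertices; equivalently $RDD(G)=\sum_{v\in V(G)}d_G(v)\widehat{D}_G(v)$ with $\widehat{D}_G(v)=\sum_{u\in V(G)\setminus\{v\}}\frac{1}{d_G(v,u)}$. For $k\geq 2$, a graph $G$ with $|V(G)|\geq k+1$ is $k$-leaf-connected if for every subset $S\subseteq V(G)$ with $|S|=k$, $G$ has a spanning tree $T$ such that $S$ is precisely the set of leaves of $T$. For vertex-disjoint graphs $G$ and $H$, $G+H$ is their disjoint union, $tG$ is the disjoint union of $t$ copies of $G$, and the join $G\vee H$ is obtained from $G+H$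 by adding all possible edges between $V(G)$ and $V(H)$. $K_n$ is the complete graph of order $n$ and $K_{1,3}$ is the star with three leaves. *)

theory Defs
  imports Complex_Main
begin

section \<open>Graphs\<close>

record 'a ugraph =
  verts :: "'a set"
  edges :: "'a set set"

definition simple_graph :: "'a ugraph \<Rightarrow> bool" where
  "simple_graph G \<longleftrightarrow> finite (verts G) \<and> (\<forall>e\<in>edges G. e \<subseteq> verts G \<and> card e = 2)"

abbreviation graph_order :: "'a ugraph \<Rightarrow> nat" where
  "graph_order G \<equiv> card (verts G)"

definition vdegree :: "'a ugraph \<Rightarrow> 'a \<Rightarrow> nat" where
  "vdegree G v = card {u \<in> verts G. {v, u} \<in> edges G}"

definition min_degree :: "'a ugraph \<Rightarrow> nat" where
  "min_degree G = Min (vdegree G ` verts G)"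

text \<open>A path is the list of its vertices; its length as a path is \<open>length p - 1\<close>.\<close>

definition is_path :: "'a ugraph \<Rightarrow> 'a \<Rightarrow> 'a list \<Rightarrow> 'a \<Rightarrow> bool" where
  "is_path G u p v \<longleftrightarrow>
     p \<noteq> [] \<and> hd p = u \<and> last p = v \<and> distinct p \<and> set p \<subseteq> verts G \<and>
     (\<forall>i. Suc i < length p \<longrightarrow> {p ! i, p ! Suc i} \<in> edges G)"

definition connected_graph :: "'a ugraph \<Rightarrow> bool" where
  "connected_graph G \<longleftrightarrow>
     verts G \<noteq> {} \<and> (\<forall>u\<in>verts G. \<forall>v\<in>verts G. \<exists>p. is_path G u p v)"

text \<open>Meaningful only if some path joins \<open>u\<close> and \<open>v\<close>.\<close>

definition distance :: "'a ugraph \<Rightarrow> 'a \<Rightarrow> 'a \<Rightarrow> nat" where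
  "distance G u v = (LEAST m. \<exists>p. is_path G u p v \<and> length p = Suc m)"

definition acyclic_graph :: "'a ugraph \<Rightarrow> bool" where
  "acyclic_graph G \<longleftrightarrow>
     \<not> (\<exists>u v p. is_path G u p v \<and> 3 \<le> length p \<and> {v, u} \<in> edges G)"

definition tree :: "'a ugraph \<Rightarrow> bool" where
  "tree T \<longleftrightarrow> simple_graph T \<and> connected_graph T \<and> acyclic_graph T"

definition spanning_tree :: "'a ugraph \<Rightarrow> 'a ugraph \<Rightarrow> bool" where
  "spanning_tree T G \<longleftrightarrow> tree T \<and> verts T = verts G \<and> edges T \<subseteq> edges G"

definition leaves :: "'a ugraph \<Rightarrow> 'a set" where
  "leaves T = {v \<in> verts T. vdegree T v = 1}"

definition k_leaf_connected :: "nat \<Rightarrow> 'a ugraph \<Rightarrow> bool" where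
  "k_leaf_connected k G \<longleftrightarrow>
     2 \<le> k \<and> k + 1 \<le> graph_order G \<and>
     (\<forall>S. S \<subseteq> verts G \<and> card S = k \<longrightarrow> (\<exists>T. spanning_tree T G \<and> leaves T = S))"

definition graph_iso :: "'a ugraph \<Rightarrow> 'b ugraph \<Rightarrow> bool" where
  "graph_iso G H \<longleftrightarrow>
     (\<exists>f. bij_betw f (verts G) (verts H) \<and>
          (\<forall>u\<in>verts G. \<forall>v\<in>verts G. {u, v} \<in> edges G \<longleftrightarrow> {f u, f v} \<in> edges H))"


section \<open>Reciprocal degree distance\<close>

text \<open>The sum ranges over the two-element subsets of the vertex set. The summand is symmetric
  in \<open>u\<close> and \<open>v\<close>, so the definite description below denotes the value for either
  enumeration of the pair; see \<open>RDD_term_pair\<close>.\<close>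

definition RDD_term :: "'a ugraph \<Rightarrow> 'a set \<Rightarrow> real" where
  "RDD_term G e =
     (THE x. \<exists>u v. u \<noteq> v \<and> e = {u, v} \<and>
        x = (real (vdegree G u) + real (vdegree G v)) / real (distance G u v))"

definition RDD :: "'a ugraph \<Rightarrow> real" where
  "RDD G = (\<Sum>e | e \<subseteq> verts G \<and> card e = 2. RDD_term G e)"

lemma is_path_rev: "is_path G u p v \<Longrightarrow> is_path G v (rev p) u"
  unfolding is_path_def
proof (intro conjI allI impI; (elim conjE)?)
  fix i assume a: "Suc i < length (rev p)"
    and e: "\<forall>i. Suc i < length p \<longrightarrow> {p ! i, p ! Suc i} \<in> edges G"
  define j where "j = length p - Suc (Suc i)"
  have j: "Suc j < length p" "length p - Suc i = Suc j" using a by (auto simp: j_def)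
  have "rev p ! i = p ! Suc j" "rev p ! Suc i = p ! j"
    using a j by (auto simp: rev_nth j_def)
  with e j show "{rev p ! i, rev p ! Suc i} \<in> edges G" by (metis insert_commute)
qed (auto simp: hd_rev last_rev)

lemma distance_commute: "distance G u v = distance G v u"
proof -
  have "(\<exists>p. is_path G u p v \<and> length p = Suc m) \<longleftrightarrow>
        (\<exists>p. is_path G v p u \<and> length p = Suc m)" for m
    using is_path_rev length_rev by metis
  then show ?thesis unfolding distance_def by simp
qed

lemma RDD_term_pair:
  assumes "u \<noteq> v"
  shows "RDD_term G {u, v} = (real (vdegree G u) + real (vdegree G v)) / real (distance G u v)"
  unfolding RDD_term_def
proof (rule the_equality)
  show "\<exists>a b. a \<noteq> b \<and> {u, v} = {a, b} \<and>
      (real (vdegree G u) + real (vdegree G v)) / real (distance G u v) =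
      (real (vdegree G a) + real (vdegree G b)) / real (distance G a b)"
    using assms by blast
qed (auto simp: doubleton_eq_iff distance_commute[of G v u] add.commute)

lemma RDD_eq_sum_degree:
  assumes fin: "finite (verts G)"
  shows "RDD G =
    (\<Sum>v\<in>verts G. real (vdegree G v) * (\<Sum>u\<in>verts G - {v}. 1 / real (distance G v u)))"
proof -
  let ?V = "verts G"
  let ?E = "{e. e \<subseteq> ?V \<and> card e = 2}"
  let ?f = "\<lambda>v u. real (vdegree G v) / real (distance G v u)"
  have finE: "finite ?E" using fin by simp
  have t: "RDD_term G e = (\<Sum>v\<in>e. \<Sum>u\<in>e - {v}. ?f v u)" if "e \<in> ?E" for e
  proof -
    from that obtain u v where uv: "e = {u, v}" "u \<noteq> v" by (auto simp: card_2_iff)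
    then have s: "{u, v} - {u} = {v}" "{u, v} - {v} = {u}" by auto
    show ?thesis using uv
      by (simp add: RDD_term_pair s distance_commute[of G v u] add_divide_distrib)
  qed
  have "RDD G = (\<Sum>e\<in>?E. \<Sum>v\<in>e. \<Sum>u\<in>e - {v}. ?f v u)"
    unfolding RDD_def using t by (intro sum.cong) auto
  also have "\<dots> = (\<Sum>e\<in>?E. \<Sum>(v, u)\<in>Sigma e (\<lambda>v. e - {v}). ?f v u)"
    by (intro sum.cong refl sum.Sigma) (auto simp: card_2_iff)
  also have "\<dots> = (\<Sum>(e, v, u)\<in>Sigma ?E (\<lambda>e. Sigma e (\<lambda>v. e - {v})). ?f v u)"
    using finE by (subst sum.Sigma) (auto simp: card_2_iff)
  also have "\<dots> = (\<Sum>(v, u)\<in>Sigma ?V (\<lambda>v. ?V - {v}). ?f v u)"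
  proof (rule sum.reindex_bij_witness[where i = "\<lambda>(v, u). ({v, u}, v, u)" and j = snd])
    fix a assume "a \<in> Sigma ?E (\<lambda>e. Sigma e (\<lambda>v. e - {v}))"
    then obtain e v u where a: "a = (e, v, u)" "e \<subseteq> ?V" "card e = 2" "v \<in> e" "u \<in> e" "u \<noteq> v"
      by auto
    then show "(case snd a of (v, u) \<Rightarrow> ({v, u}, v, u)) = a" by (auto simp: card_2_iff)
  qed (auto simp: card_2_iff)
  also have "\<dots> = (\<Sum>v\<in>?V. \<Sum>u\<in>?V - {v}. ?f v u)"
    using fin by (subst sum.Sigma) auto
  finally show ?thesis by (simp add: sum_distrib_left)
qed


section \<open>Constructions\<close>

definition complete_graph :: "nat \<Rightarrow> nat ugraph" where
  "complete_graph n = \<lparr>verts = {..<n}, edges = {e. e \<subseteq> {..<n} \<and> card e = 2}\<rparr>"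

text \<open>The star with \<open>t\<close> leaves, centred at \<open>0\<close>.\<close>

definition star_graph :: "nat \<Rightarrow> nat ugraph" where
  "star_graph t = \<lparr>verts = {..t}, edges = {{0, i} | i. 1 \<le> i \<and> i \<le> t}\<rparr>"

definition disjoint_union :: "'a ugraph \<Rightarrow> 'b ugraph \<Rightarrow> ('a + 'b) ugraph" where
  "disjoint_union G H =
     \<lparr>verts = verts G <+> verts H,
      edges = (\<lambda>e. Inl ` e) ` edges G \<union> (\<lambda>e. Inr ` e) ` edges H\<rparr>"

definition graph_join :: "'a ugraph \<Rightarrow> 'b ugraph \<Rightarrow> ('a + 'b) ugraph" where
  "graph_join G H =
     \<lparr>verts = verts (disjoint_union G H),
      edges = edges (disjoint_union G H) \<union> {{Inl u, Inr v} | u v. u \<in> verts G \<and> v \<in> verts H}\<rparr>"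

definition copies :: "nat \<Rightarrow> 'a ugraph \<Rightarrow> (nat \<times> 'a) ugraph" where
  "copies t G =
     \<lparr>verts = {..<t} \<times> verts G,
      edges = {Pair i ` e | i e. i < t \<and> e \<in> edges G}\<rparr>"

end

theory Submission
  imports Defs
begin

text \<open>Write \<open>n\<close> for the order of \<open>G\<close>, \<open>m = n - k\<close>, and let the codegree of a vertex be its degree in the
complement of \<open>G\<close>. Let \<open>S\<close> be a \<open>k\<close>-set that is not the leaf set of a spanning tree. Whenever
\<open>S = R \<union> {s, t}\<close> with \<open>card R = k - 2\<close>, the graph \<open>G - R\<close> has no Hamilton path from \<open>s\<close> to \<open>t\<close>:
minimum degree \<open>k + 1\<close> gives each vertex of \<open>R\<close> a neighbour outside \<open>S\<close>, so the vertices of \<open>R\<close>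
could be hung as leaves on the inner vertices of such a path. This reduces the question to
Hamilton paths with prescribed ends in a graph with \<open>m + 2\<close> vertices.

The closure argument of Bondy and Chvatal (\<open>ore_codeg\<close>) and Chvatal's degree-sequence argument
(\<open>chvatal_codeg\<close>) then yield a number \<open>j\<close> with \<open>2 * j \<le> m\<close> and sets \<open>A \<subseteq> M\<close> outside \<open>R\<close>, of sizes
\<open>j\<close> and \<open>m + 1 - j\<close>, such that codegrees are at least \<open>m - j\<close> on \<open>A\<close> and at least \<open>j\<close> on \<open>M\<close>.
Equality everywhere is attained by the join of a complete graph on \<open>k + j - 1\<close> vertices with
\<open>j\<close> isolated vertices and a clique on \<open>m + 1 - 2 * j\<close> vertices.

On the other side, since nonadjacent vertices have distance at least 2, \<open>RDD G\<close> is at most a sum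
over the vertices of a decreasing function of the codegree (\<open>RDD_le_codeg\<close>). The assumed lower
bound on \<open>RDD G\<close> is the value of this sum for the above join with \<open>j = 2\<close>. A calculation with the
two estimates (\<open>nearly_extremal_of_cost_le\<close>) leaves only \<open>j = 2\<close> and
\<open>(m, j) \<in> {(6, 3), (7, 3), (8, 4)}\<close>, and it forces the codegrees to be exactly those of the join;
only for \<open>(6, 3)\<close> is there room to delete one further edge. The codegrees determine the graph.

If \<open>k = 2\<close>, the resulting graphs are the listed exceptions. If \<open>k \<ge> 3\<close>, every element of \<open>S\<close> lies
in a suitable \<open>R\<close>, and since the vertices of \<open>M\<close> are recognised by their codegrees, \<open>S\<close> is
disjoint from \<open>M\<close>. A path between two elements of \<open>S\<close> then passes through all of \<open>A\<close>, and a third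
element of \<open>S\<close> can end a side branch through \<open>M - A\<close>; this is a spanning tree with leaf set \<open>S\<close>
(\<open>leaf_tree_spider\<close>), a contradiction.\<close>

section \<open>Hamilton paths with prescribed ends\<close>

definition hamilton_path :: "'a set set \<Rightarrow> 'a set \<Rightarrow> 'a \<Rightarrow> 'a list \<Rightarrow> 'a \<Rightarrow> bool" where
  "hamilton_path E V s p t \<longleftrightarrow>
     p \<noteq> [] \<and> distinct p \<and> set p = V \<and> hd p = s \<and> last p = t \<and>
     successively (\<lambda>x y. {x, y} \<in> E) p"

text \<open>The degree in the complement. It can only decrease when edges are added or vertices are removed,
which makes it easy to compare a graph with its edge-maximal extensions and induced subgraphs.\<close>

definition codeg :: "'a set set \<Rightarrow> 'a set \<Rightarrow> 'a \<Rightarrow> nat" where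
  "codeg E V v = card {u \<in> V. u \<noteq> v \<and> {v, u} \<notin> E}"

lemma successively_sym_rev:
  "successively (\<lambda>x y. {x, y} \<in> E) (rev xs) \<longleftrightarrow> successively (\<lambda>x y. {x, y} \<in> E) xs"
proof -
  have "(\<lambda>x y. {y, x} \<in> E) = (\<lambda>x y. {x, y} \<in> E)" by (intro ext) (metis insert_commute)
  then show ?thesis by (subst successively_rev) (simp only:)
qed

lemma rotate_before:
  assumes "hamilton_path (insert {u, v} E) V s (xs1 @ xs2 @ ys) t"
    and ne: "xs1 \<noteq> []" "xs2 \<noteq> []" "ys \<noteq> []"
    and sx: "successively (\<lambda>x y. {x, y} \<in> E) (xs1 @ xs2)"
    and sy: "successively (\<lambda>x y. {x, y} \<in> E) ys"
    and l: "{last xs1, last xs2} \<in> E" "{hd xs2, hd ys} \<in> E"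
  shows "hamilton_path E V s (xs1 @ rev xs2 @ ys) t"
  using assms unfolding hamilton_path_def
  by (auto simp: successively_append_iff successively_sym_rev hd_rev last_rev
      simp del: successively_rev)

lemma rotate_after:
  assumes "hamilton_path (insert {u, v} E) V s (xs @ ys1 @ ys2) t"
    and ne: "xs \<noteq> []" "ys1 \<noteq> []" "ys2 \<noteq> []"
    and sx: "successively (\<lambda>x y. {x, y} \<in> E) xs"
    and sy: "successively (\<lambda>x y. {x, y} \<in> E) (ys1 @ ys2)"
    and l: "{last xs, last ys1} \<in> E" "{hd ys1, hd ys2} \<in> E"
  shows "hamilton_path E V s (xs @ rev ys1 @ ys2) t"
  using assms unfolding hamilton_path_def
  by (auto simp: successively_append_iff successively_sym_rev hd_rev last_rev
      simp del: successively_rev)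

text \<open>A path traverses the new edge at most once, so removing it leaves two paths in the old graph.\<close>

lemma successively_new_edge:
  assumes "successively (\<lambda>x y. {x, y} \<in> insert e E) p" "distinct p"
    "\<not> successively (\<lambda>x y. {x, y} \<in> E) p"
  shows "\<exists>xs ys. p = xs @ ys \<and> xs \<noteq> [] \<and> ys \<noteq> [] \<and> {last xs, hd ys} = e \<and>
    successively (\<lambda>x y. {x, y} \<in> E) xs \<and> successively (\<lambda>x y. {x, y} \<in> E) ys"
  using assms
proof (induction p rule: induct_list012)
  case (3 x y zs)
  show ?case
  proof (cases "{x, y} = e")
    case True
    have "successively (\<lambda>x y. {x, y} \<in> E) (y # zs)"
    proof (rule successively_mono[where P = "\<lambda>a b. {a, b} \<in> insert e E \<and> a \<noteq> x \<and> b \<noteq> x"])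
      have "successively (\<lambda>a b. {a, b} \<in> insert e E) (y # zs)" "x \<notin> set (y # zs)"
        using "3.prems" by auto
      then show "successively (\<lambda>a b. {a, b} \<in> insert e E \<and> a \<noteq> x \<and> b \<noteq> x) (y # zs)"
        by (induction zs arbitrary: y) auto
    next
      fix a b assume "{a, b} \<in> insert e E \<and> a \<noteq> x \<and> b \<noteq> x"
      then show "{a, b} \<in> E" using True by blast
    qed
    then show ?thesis using True by (intro exI[of _ "[x]"] exI[of _ "y # zs"]) simp
  next
    case False
    then have "\<exists>xs ys. y # zs = xs @ ys \<and> xs \<noteq> [] \<and> ys \<noteq> [] \<and> {last xs, hd ys} = e \<and>
      successively (\<lambda>x y. {x, y} \<in> E) xs \<and> successively (\<lambda>x y. {x, y} \<in> E) ys"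
      using "3.prems" by (intro "3.IH"(2)) auto
    then obtain xs ys where *: "y # zs = xs @ ys" "xs \<noteq> []" "ys \<noteq> []" "{last xs, hd ys} = e"
      "successively (\<lambda>x y. {x, y} \<in> E) xs" "successively (\<lambda>x y. {x, y} \<in> E) ys" by blast
    have "successively (\<lambda>x y. {x, y} \<in> E) (x # xs)"
    proof (cases xs)
      case (Cons z zs')
      then have "z = y" using *(1) by simp
      then show ?thesis using *(5) False "3.prems"(1) Cons by simp
    qed simp
    then show ?thesis using * by (intro exI[of _ "x # xs"] exI[of _ ys]) simp
  qed
qed auto

lemma codeg_plus_degree:
  assumes "finite V" "v \<in> V" "{v} \<notin> E"
  shows "codeg E V v + card {u \<in> V. {v, u} \<in> E} = card V - 1"
proof -
  have "V - {v} = {u \<in> V. u \<noteq> v \<and> {v, u} \<notin> E} \<union> {u \<in> V. {v, u} \<in> E}"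
    using assms by auto
  moreover have "card ({u \<in> V. u \<noteq> v \<and> {v, u} \<notin> E} \<union> {u \<in> V. {v, u} \<in> E}) =
     codeg E V v + card {u \<in> V. {v, u} \<in> E}"
    unfolding codeg_def using assms by (intro card_Un_disjoint) auto
  ultimately show ?thesis using assms by (metis card_Diff_singleton)
qed

text \<open>Let the Hamilton path in the enlarged graph be \<open>xs @ ys\<close> with the new edge between \<open>u = last xs\<close> and
\<open>v = hd ys\<close>. If some two consecutive vertices \<open>p ! i\<close> and \<open>p ! Suc i\<close> were old neighbours of \<open>u\<close> and
\<open>v\<close> respectively, reversing the segment between them and the new edge would give a Hamilton path
that avoids the new edge. So the positions before neighbours of \<open>v\<close> are disjoint from the positions
of neighbours of \<open>u\<close>, and the degrees of \<open>u\<close> and \<open>v\<close> add up to at most the order.\<close>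

lemma ore_codeg:
  assumes fin: "finite V" and noloop: "\<forall>x. {x} \<notin> E"
    and no: "\<nexists>p. hamilton_path E V s p t"
    and ham: "hamilton_path (insert {u, v} E) V s p t"
    and uv: "u \<in> V" "v \<in> V" "{u, v} \<notin> E" "u \<noteq> v"
  shows "card V \<le> codeg E V u + codeg E V v + 2"
proof -
  have main: "card V \<le> codeg E V u + codeg E V v + 2"
    if p: "p = xs @ ys" and ne: "xs \<noteq> []" "ys \<noteq> []" and "last xs = u" "hd ys = v"
      and sx: "successively (\<lambda>x y. {x, y} \<in> E) xs"
      and sy: "successively (\<lambda>x y. {x, y} \<in> E) ys"
      and uv: "u \<in> V" "v \<in> V" "{u, v} \<notin> E" "u \<noteq> v"
      and ham: "hamilton_path (insert {u, v} E) V s p t"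
    for u v xs ys
  proof -
    define L where "L = length p"
    have d: "distinct p" "set p = V" "p \<noteq> []" using ham by (auto simp: hamilton_path_def)
    have L: "L = card V" using d distinct_card L_def by metis
    define j where "j = length xs - 1"
    have j: "Suc j < L" "p ! j = u" "p ! Suc j = v"
      using p ne that(4,5) by (auto simp: L_def j_def nth_append last_conv_nth hd_conv_nth)
    define I where "I = {i. Suc i < L \<and> {u, p ! i} \<in> E}"
    define J where "J = {i. Suc i < L \<and> {v, p ! Suc i} \<in> E}"
    have False if i: "i \<in> I" "i \<in> J" for i
    proof -
      have iL: "Suc i < length p" "{u, p ! i} \<in> E" "{v, p ! Suc i} \<in> E"
        using i by (auto simp: I_def J_def L_def)
      have "i \<noteq> j" using iL j noloop by auto
      then consider "i < j" | "j < i" by linarith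
      then show False
      proof cases
        case 1
        define xs1 xs2 where "xs1 = take (Suc i) xs" and "xs2 = drop (Suc i) xs"
        have x: "xs = xs1 @ xs2" "xs1 \<noteq> []" "xs2 \<noteq> []" "last xs2 = u" "last xs1 = p ! i"
          "hd xs2 = p ! Suc i"
        proof -
          have l: "Suc i < length xs" using 1 ne by (auto simp: j_def)
          then show "xs = xs1 @ xs2" "xs1 \<noteq> []" "xs2 \<noteq> []" "last xs2 = u"
            using \<open>last xs = u\<close> by (auto simp: xs1_def xs2_def)
          show "last xs1 = p ! i" "hd xs2 = p ! Suc i"
            using l p by (simp_all add: xs1_def xs2_def hd_drop_conv_nth nth_append
                take_Suc_conv_app_nth)
        qed
        have "hamilton_path E V s (xs1 @ rev xs2 @ ys) t"
        proof (rule rotate_before[of u v])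
          show "{last xs1, last xs2} \<in> E" "{hd xs2, hd ys} \<in> E"
            using iL x \<open>hd ys = v\<close> by (metis insert_commute)+
        qed (use ham p x ne sx sy in auto)
        then show ?thesis using no by blast
      next
        case 2
        define r where "r = i - length xs"
        define ys1 ys2 where "ys1 = take (Suc r) ys" and "ys2 = drop (Suc r) ys"
        have r: "i = length xs + r" "Suc r < length ys" using 2 ne iL p by (auto simp: r_def j_def)
        have y: "ys = ys1 @ ys2" "ys1 \<noteq> []" "ys2 \<noteq> []" "hd ys1 = v" "last ys1 = p ! i"
          "hd ys2 = p ! Suc i"
        proof -
          show "ys = ys1 @ ys2" "ys1 \<noteq> []" "ys2 \<noteq> []" "hd ys1 = v"
            using \<open>hd ys = v\<close> r ne(2) by (auto simp: ys1_def ys2_def)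
          show "last ys1 = p ! i" "hd ys2 = p ! Suc i"
            using r p by (simp_all add: ys1_def ys2_def hd_drop_conv_nth nth_append
                take_Suc_conv_app_nth)
        qed
        have "hamilton_path E V s (xs @ rev ys1 @ ys2) t"
          by (rule rotate_after[of u v])
            (use ham p y ne sx sy iL \<open>last xs = u\<close> in \<open>simp_all\<close>)
        then show ?thesis using no by blast
      qed
    qed
    then have dis: "I \<inter> J = {}" by blast
    \<comment> \<open>The position \<open>j\<close> of the new edge itself is in neither set, which saves one more.\<close>
    have sub: "I \<union> J \<subseteq> {..<L - 1} - {j}" using j noloop by (auto simp: I_def J_def)
    have finIJ: "finite I" "finite J" using sub finite_subset by (auto simp: I_def J_def)
    have "card I + card J = card (I \<union> J)" using finIJ dis by (simp add: card_Un_disjoint)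
    also have "\<dots> \<le> card ({..<L - 1} - {j})" using sub by (intro card_mono) auto
    also have "\<dots> = L - 2" using j by (subst card_Diff_singleton) auto
    finally have IJ: "card I + card J \<le> L - 2" .
    \<comment> \<open>The last vertex has no successor and the first no predecessor, hence the two exceptions.\<close>
    have "{x \<in> V. {u, x} \<in> E} \<subseteq> insert (last p) ((!) p ` I)"
    proof
      fix x assume x: "x \<in> {x \<in> V. {u, x} \<in> E}"
      then obtain i where i: "i < L" "x = p ! i" using d by (auto simp: in_set_conv_nth L_def)
      then show "x \<in> insert (last p) ((!) p ` I)"
      proof (cases "Suc i < L")
        case False
        then have "i = length p - 1" using i by (simp add: L_def)
        then show ?thesis using i d(3) by (simp add: last_conv_nth)
      qed (use x i in \<open>simp add: I_def\<close>)
    qed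
    then have "card {x \<in> V. {u, x} \<in> E} \<le> card (insert (last p) ((!) p ` I))"
      using finIJ by (intro card_mono) auto
    also have "\<dots> \<le> Suc (card I)"
      using finIJ by (metis card_image_le card_insert_le_m1 diff_Suc_1 zero_less_Suc)
    finally have du: "card {x \<in> V. {u, x} \<in> E} \<le> Suc (card I)" .
    have "{x \<in> V. {v, x} \<in> E} \<subseteq> insert (hd p) ((\<lambda>i. p ! Suc i) ` J)"
    proof
      fix x assume x: "x \<in> {x \<in> V. {v, x} \<in> E}"
      then obtain i where i: "i < L" "x = p ! i" using d by (auto simp: in_set_conv_nth L_def)
      then show "x \<in> insert (hd p) ((\<lambda>i. p ! Suc i) ` J)"
      proof (cases i)
        case 0
        then show ?thesis using i d(3) by (simp add: hd_conv_nth)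
      qed (use x i in \<open>auto simp: J_def\<close>)
    qed
    then have "card {x \<in> V. {v, x} \<in> E} \<le> card (insert (hd p) ((\<lambda>i. p ! Suc i) ` J))"
      using finIJ by (intro card_mono) auto
    also have "\<dots> \<le> Suc (card J)"
      using finIJ by (metis card_image_le card_insert_le_m1 diff_Suc_1 zero_less_Suc)
    finally have dv: "card {x \<in> V. {v, x} \<in> E} \<le> Suc (card J)" .
    show ?thesis
      using du dv IJ L j codeg_plus_degree[OF fin uv(1), of E] codeg_plus_degree[OF fin uv(2), of E]
        noloop by auto
  qed
  have "\<not> successively (\<lambda>x y. {x, y} \<in> E) p" using no ham by (auto simp: hamilton_path_def)
  then obtain xs ys where p: "p = xs @ ys" "xs \<noteq> []" "ys \<noteq> []" "{last xs, hd ys} = {u, v}"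
    "successively (\<lambda>x y. {x, y} \<in> E) xs" "successively (\<lambda>x y. {x, y} \<in> E) ys"
    using successively_new_edge[of "{u, v}" E p] ham by (auto simp: hamilton_path_def)
  from p(4) consider "last xs = u" "hd ys = v" | "last xs = v" "hd ys = u"
    by (auto simp: doubleton_eq_iff)
  then show ?thesis
  proof cases
    case 1 then show ?thesis using main[OF p(1-3) 1 p(5,6) uv ham] by simp
  next
    case 2
    have "hamilton_path (insert {v, u} E) V s p t" using ham by (simp add: insert_commute)
    then show ?thesis using main[OF p(1-3) 2 p(5,6) uv(2,1)] uv by (simp add: insert_commute add.commute)
  qed
qed

lemma hamilton_path_complete:
  assumes "finite V" "s \<in> V" "t \<in> V" "s \<noteq> t" and E: "\<forall>x\<in>V. \<forall>y\<in>V. x \<noteq> y \<longrightarrow> {x, y} \<in> E"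
  shows "\<exists>p. hamilton_path E V s p t"
proof -
  obtain xs where xs: "set xs = V - {s, t}" "distinct xs"
    using finite_distinct_list[of "V - {s, t}"] assms(1) by blast
  define p where "p = s # xs @ [t]"
  have p: "distinct p" "set p = V" "p \<noteq> []" "hd p = s" "last p = t"
    using xs assms(2-4) by (auto simp: p_def)
  have "distinct q \<Longrightarrow> successively (\<lambda>x y. x \<noteq> y) q" for q :: "'a list"
    by (induction q rule: induct_list012) auto
  then have "successively (\<lambda>x y. x \<noteq> y) p" using p(1) .
  then have "successively (\<lambda>x y. {x, y} \<in> E) p"
    by (rule successively_mono) (use p(2) E in blast)
  then show ?thesis using p unfolding hamilton_path_def by blast
qed

lemma codeg_mono:
  assumes "finite V" "V' \<subseteq> V" and "\<And>y. y \<in> V' \<Longrightarrow> y \<noteq> v \<Longrightarrow> {v, y} \<in> E \<Longrightarrow> {v, y} \<in> E'"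
  shows "codeg E' V' v \<le> codeg E V v"
  unfolding codeg_def by (rule card_mono) (use assms in auto)

text \<open>Adding edges as long as no Hamilton path from \<open>s\<close> to \<open>t\<close> arises leads to an edge-maximal graph \<open>F\<close>,
in which by \<open>ore_codeg\<close> the codegrees of nonadjacent vertices sum to at least \<open>m\<close>. Choose a
nonadjacent pair \<open>u\<close>, \<open>v\<close> with least codegree sum and let \<open>a\<close>, the codegree of \<open>u\<close>, be the larger
of the two. By minimality all non-neighbours of \<open>v\<close> have codegree at least \<open>a\<close>, and all
non-neighbours of \<open>u\<close> have at least the codegree of \<open>v\<close>, which is at least \<open>m - a\<close>.\<close>

lemma chvatal_codeg:
  assumes fin: "finite V" and st: "s \<in> V" "t \<in> V" "s \<noteq> t"
    and cV: "card V = m + 2"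
    and no: "\<nexists>p. hamilton_path E V s p t"
  shows "\<exists>u\<in>V. \<exists>a A M. a \<le> codeg E V u \<and> m \<le> 2 * a \<and> A \<subseteq> M \<and> M \<subseteq> V \<and>
    card A = m - a \<and> card M = a + 1 \<and>
    (\<forall>v\<in>A. a \<le> codeg E V v) \<and> (\<forall>v\<in>M. m - a \<le> codeg E V v)"
proof -
  define P where "P = {e. e \<subseteq> V \<and> card e = 2}"
  define \<F> where "\<F> = {F. F \<subseteq> P \<and> E \<inter> P \<subseteq> F \<and> (\<nexists>p. hamilton_path F V s p t)}"
  have "\<F> \<subseteq> Pow (Pow V)" unfolding \<F>_def P_def by blast
  then have finF: "finite \<F>" using fin finite_subset by blast
  have "hamilton_path E V s p t" if "hamilton_path (E \<inter> P) V s p t" for p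
  proof -
    have "successively (\<lambda>x y. {x, y} \<in> E \<inter> P) p" using that by (simp add: hamilton_path_def)
    then have "successively (\<lambda>x y. {x, y} \<in> E) p" by (rule successively_mono) simp
    then show ?thesis using that by (simp add: hamilton_path_def)
  qed
  then have "E \<inter> P \<in> \<F>" using no unfolding \<F>_def by blast
  then obtain F where F: "F \<in> \<F>" "\<forall>F'\<in>\<F>. F \<subseteq> F' \<longrightarrow> F = F'"
    using finite_has_maximal2[OF finF, of "E \<inter> P"] by blast
  have noF: "\<nexists>p. hamilton_path F V s p t" and FP: "F \<subseteq> P" "E \<inter> P \<subseteq> F"
    using F(1) by (simp_all add: \<F>_def)
  have noloop: "\<forall>x. {x} \<notin> F" using FP by (auto simp: P_def)
  let ?c = "codeg F V"
  define N where "N = {(u, v). u \<in> V \<and> v \<in> V \<and> u \<noteq> v \<and> {u, v} \<notin> F}"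
  have le: "?c v \<le> codeg E V v" if "v \<in> V" for v
  proof (rule codeg_mono[OF fin order.refl])
    fix y assume "y \<in> V" "y \<noteq> v" "{v, y} \<in> E"
    then have "{v, y} \<in> E \<inter> P" using that by (simp add: P_def)
    then show "{v, y} \<in> F" using FP(2) by blast
  qed
  have "N \<noteq> {}"
  proof
    assume "N = {}"
    then have "\<forall>x\<in>V. \<forall>y\<in>V. x \<noteq> y \<longrightarrow> {x, y} \<in> F" by (auto simp: N_def)
    then show False using hamilton_path_complete[OF fin st] noF by blast
  qed
  then obtain z0 where "z0 \<in> N" by blast
  then obtain z where z: "z \<in> N" "\<And>y. y \<in> N \<Longrightarrow> ?c (fst z) + ?c (snd z) \<le> ?c (fst y) + ?c (snd y)"
    using ex_has_least_nat[of "\<lambda>z. z \<in> N" z0 "\<lambda>z. ?c (fst z) + ?c (snd z)"] by blast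
  have Nsym: "(y, x) \<in> N" if "(x, y) \<in> N" for x y
    using that by (auto simp: N_def insert_commute)
  obtain u v where uv: "(u, v) \<in> N" "?c v \<le> ?c u"
    and least: "\<And>x y. (x, y) \<in> N \<Longrightarrow> ?c u + ?c v \<le> ?c x + ?c y"
  proof -
    obtain u v where z': "z = (u, v)" by (cases z)
    have l: "?c u + ?c v \<le> ?c x + ?c y" if "(x, y) \<in> N" for x y using z(2)[OF that] z' by simp
    show ?thesis
    proof (cases "?c v \<le> ?c u")
      case True
      show ?thesis by (rule that[of u v]) (use True z(1) z' l in \<open>blast+\<close>)
    next
      case False
      have "?c v + ?c u \<le> ?c x + ?c y" if "(x, y) \<in> N" for x y
        using l[OF that] by linarith
      then show ?thesis using that[of v u] Nsym[of u v] False z(1) z' by simp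
    qed
  qed
  have uvV: "u \<in> V" "v \<in> V" "u \<noteq> v" "{u, v} \<notin> F" using uv by (auto simp: N_def)
  have "m \<le> ?c u + ?c v"
  proof -
    have sub: "insert {u, v} F \<subseteq> P" using FP(1) uvV(1-3) by (simp add: P_def)
    have "insert {u, v} F \<notin> \<F>"
    proof
      assume "insert {u, v} F \<in> \<F>"
      with F(2) have "F = insert {u, v} F" by (meson subset_insertI)
      then show False using uvV(4) by (metis insertI1)
    qed
    moreover have "E \<inter> P \<subseteq> insert {u, v} F" using FP(2) by (meson subset_insertI order_trans)
    ultimately have "\<not> (\<nexists>p. hamilton_path (insert {u, v} F) V s p t)"
      using sub unfolding \<F>_def by simp
    then obtain p where "hamilton_path (insert {u, v} F) V s p t" by blast
    from ore_codeg[OF fin noloop noF this uvV(1,2,4,3)] show ?thesis using cV by simp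
  qed
  define a where "a = ?c u"
  define A0 where "A0 = {x \<in> V. x \<noteq> v \<and> {v, x} \<notin> F}"
  define B0 where "B0 = insert u {x \<in> V. x \<noteq> u \<and> {u, x} \<notin> F}"
  have fA0: "finite A0" "finite B0" using fin by (auto simp: A0_def B0_def)
  have A0: "A0 \<subseteq> V" "card A0 = ?c v" "\<And>x. x \<in> A0 \<Longrightarrow> a \<le> ?c x"
  proof -
    show "a \<le> ?c x" if "x \<in> A0" for x
    proof -
      have "(x, v) \<in> N" using that uvV by (auto simp: A0_def N_def insert_commute)
      from least[OF this] show ?thesis by (simp add: a_def)
    qed
  qed (auto simp: A0_def codeg_def)
  have B0: "B0 \<subseteq> V" "card B0 = a + 1" "\<And>x. x \<in> B0 \<Longrightarrow> m - a \<le> ?c x"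
  proof -
    show "card B0 = a + 1" using fin unfolding B0_def a_def codeg_def by (subst card_insert_disjoint) auto
    show "m - a \<le> ?c x" if "x \<in> B0" for x
    proof (cases "x = u")
      case False
      then have "(u, x) \<in> N" using that uvV by (auto simp: B0_def N_def)
      from least[OF this] show ?thesis using \<open>m \<le> ?c u + ?c v\<close> by (simp add: a_def)
    next
      case True
      then show ?thesis using uv(2) \<open>m \<le> ?c u + ?c v\<close> by (simp add: a_def)
    qed
  qed (use uvV in \<open>auto simp: B0_def\<close>)
  have ma: "m - a \<le> card A0" "m - a \<le> a" "a \<le> ?c u"
    using A0(2) uv(2) \<open>m \<le> ?c u + ?c v\<close> by (auto simp: a_def)
  obtain A where A: "A \<subseteq> A0" "card A = m - a"
    using ma(1) by (meson obtain_subset_with_card_n)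
  have "a + 1 \<le> card (A \<union> B0)" using B0(2) fA0 A
    by (metis card_mono finite_UnI finite_subset sup_ge2)
  moreover have "card A \<le> a + 1" using A ma by simp
  ultimately obtain M where M: "A \<subseteq> M" "M \<subseteq> A \<union> B0" "card M = a + 1"
    using exists_subset_between[of A "a + 1" "A \<union> B0"] fA0 A by (metis finite_UnI finite_subset sup_ge1)
  have "m - a \<le> ?c x" if "x \<in> M" for x
  proof (cases "x \<in> B0")
    case False
    then have "a \<le> ?c x" using that M A A0(3) by blast
    then show ?thesis using ma by simp
  qed (use B0(3) in blast)
  moreover have "a \<le> ?c x" if "x \<in> A" for x using that A A0(3) by blast
  moreover have "A \<subseteq> V" "M \<subseteq> V" using A(1) A0(1) B0(1) M(2) by blast+
  ultimately have "\<forall>x\<in>A. a \<le> codeg E V x" "\<forall>x\<in>M. m - a \<le> codeg E V x"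
    using le by (meson order_trans subsetD)+
  moreover have "a \<le> codeg E V u" "m \<le> 2 * a" using ma le[OF uvV(1)] by linarith+
  ultimately show ?thesis
    using A(2) M(1,3) uvV(1) \<open>M \<subseteq> V\<close> by blast
qed

section \<open>Codegree sequences close to the extremal one\<close>

text \<open>In a graph of order \<open>q + 1\<close> and diameter at most 2 a vertex of codegree \<open>x\<close> has degree \<open>q - x\<close> and
contributes \<open>(q - x) * (q - x + x / 2) = q\<^sup>2 - cost q x / 2\<close> to the reciprocal degree distance.\<close>

definition cost :: "real \<Rightarrow> nat \<Rightarrow> real" where
  "cost q x = 3 * q * real x - (real x)\<^sup>2"

text \<open>The total cost of the extremal graph: two vertices of codegree \<open>m - 2\<close> and \<open>m - 3\<close> vertices of
codegree 2, all others being joined to everything.\<close>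

definition cost_bound :: "real \<Rightarrow> nat \<Rightarrow> real" where
  "cost_bound q m = 3 * q * (4 * real m - 10) - (2 * (real m)\<^sup>2 - 4 * real m - 4)"

lemma cost_diff: "cost q y - cost q x = (real y - real x) * (3 * q - real x - real y)"
  by (simp add: cost_def algebra_simps power2_eq_square)

lemma cost_diff_ge:
  assumes "x \<le> y" "y \<le> m"
  shows "(real y - real x) * (3 * q - 2 * real m) \<le> cost q y - cost q x"
  unfolding cost_diff by (rule mult_left_mono) (use assms in auto)

text \<open>The left-hand side compares two such joins: \<open>s\<close> independent vertices of codegree \<open>m - s\<close> and a
clique of \<open>m + 1 - 2 * s\<close> vertices of codegree \<open>s\<close>, against the case \<open>s = 2\<close>. Hence the factor
\<open>s - 2\<close>.\<close>

lemma extremal_cost_minus_bound: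
  assumes "2 * s \<le> m"
  shows "real s * cost q (m - s) + real (m + 1 - 2 * s) * cost q s - cost_bound q m
    = (real s - 2) * (3 * q * (2 * real m - 3 * real s - 5)
        - ((real m)\<^sup>2 - real m * real s - 2 * real m - (real s)\<^sup>2 - real s - 2))"
  using assms unfolding cost_def cost_bound_def
  by (simp add: of_nat_diff algebra_simps power2_eq_square power3_eq_cube)

text \<open>The sign of the difference is that of the second factor \<open>K\<close> in \<open>extremal_cost_minus_bound\<close>. For
\<open>m \<ge> 10\<close> the coefficient of \<open>q\<close> in it is nonnegative because \<open>2 * s \<le> m\<close>, so it suffices that \<open>K\<close>
is positive at \<open>q = m + 1\<close>. Six pairs \<open>(m, s)\<close> with \<open>m < 10\<close> remain and are checked one by one.\<close>

lemma extremal_cost_le_bound: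
  assumes s: "3 \<le> s" "2 * s \<le> m" and q: "real m + 1 \<le> q"
    and le: "real s * cost q (m - s) + real (m + 1 - 2 * s) * cost q s \<le> cost_bound q m"
  shows "(m, s) \<in> {(6, 3), (7, 3), (8, 4)}"
proof -
  define K where "K = 3 * q * (2 * real m - 3 * real s - 5)
        - ((real m)\<^sup>2 - real m * real s - 2 * real m - (real s)\<^sup>2 - real s - 2)"
  have "(real s - 2) * K \<le> 0"
    using extremal_cost_minus_bound[OF s(2), of q] le by (simp add: K_def)
  moreover have "0 < real s - 2" using s by simp
  ultimately have K: "K \<le> 0" by (simp add: mult_le_0_iff)
  have "m < 10"
  proof (rule ccontr)
    assume "\<not> m < 10"
    then have m: "10 \<le> real m" by simp
    have sm: "2 * real s \<le> real m" "3 \<le> real s" using s by linarith+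
    have "3 * (real m + 1) * (2 * real m - 3 * real s - 5) \<le> 3 * q * (2 * real m - 3 * real s - 5)"
      using m sm q by (intro mult_right_mono) auto
    then have K1: "5 * (real m)\<^sup>2 - 8 * real m * real s - 7 * real m + (real s)\<^sup>2 - 8 * real s - 13 \<le> K"
      unfolding K_def by (simp add: algebra_simps power2_eq_square)
    \<comment> \<open>Substituting \<open>m = 2 * s + d\<close> leaves products whose factors are nonnegative except for small \<open>s\<close>.\<close>
    define d where "d = real m - 2 * real s"
    have d: "0 \<le> d" "real m = 2 * real s + d" using sm by (auto simp: d_def)
    have "5 * (real m)\<^sup>2 - 8 * real m * real s - 7 * real m + (real s)\<^sup>2 - 8 * real s - 13
      = real s * (5 * real s - 22) + d * (12 * real s + 5 * d - 7) - 13"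
      unfolding d(2) by (simp add: algebra_simps power2_eq_square)
    moreover have "0 \<le> d * (12 * real s + 5 * d - 7)" using d sm by (intro mult_nonneg_nonneg) auto
    moreover have "0 < real s * (5 * real s - 22) + d * (12 * real s + 5 * d - 7) - 13"
    proof (cases "5 \<le> s")
      case True
      then have "5 * 3 \<le> real s * (5 * real s - 22)" by (intro mult_mono) auto
      then show ?thesis using \<open>0 \<le> d * (12 * real s + 5 * d - 7)\<close> by linarith
    next
      case False
      then have s34: "s = 3 \<or> s = 4" using s by auto
      have "2 \<le> d" using s34 m d(2) by auto
      then have "2 * 39 \<le> d * (12 * real s + 5 * d - 7)" using sm by (intro mult_mono) auto
      then show ?thesis using s34 by auto
    qed
    ultimately show False using K K1 by linarith
  qed
  then have "m \<in> {6, 7, 8, 9}" using s by auto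
  then have "(m, s) \<in> {(6, 3), (7, 3), (8, 3), (8, 4), (9, 3), (9, 4)}" using s by auto
  then show ?thesis using K q unfolding K_def by (auto simp: power2_eq_square)
qed

text \<open>The handshake lemma in the complement.\<close>

lemma sum_codeg_even:
  assumes fin: "finite V"
  shows "even (\<Sum>v\<in>V. codeg E V v)"
proof -
  define N where "N = {e. e \<subseteq> V \<and> card e = 2 \<and> e \<notin> E}"
  have c: "codeg E V v = card {e \<in> N. v \<in> e}" if "v \<in> V" for v
  proof -
    have "bij_betw (\<lambda>u. {v, u}) {u \<in> V. u \<noteq> v \<and> {v, u} \<notin> E} {e \<in> N. v \<in> e}"
      unfolding bij_betw_def
    proof
      show "inj_on (\<lambda>u. {v, u}) {u \<in> V. u \<noteq> v \<and> {v, u} \<notin> E}"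
        by (auto simp: inj_on_def doubleton_eq_iff)
      show "(\<lambda>u. {v, u}) ` {u \<in> V. u \<noteq> v \<and> {v, u} \<notin> E} = {e \<in> N. v \<in> e}"
      proof (intro equalityI subsetI)
        fix e assume e: "e \<in> {e \<in> N. v \<in> e}"
        then have "card (e - {v}) = 1" by (simp add: N_def)
        then obtain u where "e - {v} = {u}" by (auto simp: card_1_singleton_iff)
        then have "e = {v, u}" "u \<noteq> v" using e by auto
        then show "e \<in> (\<lambda>u. {v, u}) ` {u \<in> V. u \<noteq> v \<and> {v, u} \<notin> E}" using e by (auto simp: N_def)
      qed (use that in \<open>auto simp: N_def\<close>)
    qed
    then show ?thesis by (simp add: codeg_def bij_betw_same_card)
  qed
  have "finite N" using fin by (simp add: N_def)
  have "(\<Sum>v\<in>V. card {e \<in> N. v \<in> e}) = 2 * card N"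
  proof (rule sum_multicount[OF fin \<open>finite N\<close>])
    show "\<forall>e\<in>N. card {v \<in> V. v \<in> e} = 2"
    proof
      fix e assume "e \<in> N"
      then have "{v \<in> V. v \<in> e} = e" "card e = 2" by (auto simp: N_def)
      then show "card {v \<in> V. v \<in> e} = 2" by simp
    qed
  qed
  then have "(\<Sum>v\<in>V. codeg E V v) = 2 * card N" using c by simp
  then show ?thesis by simp
qed

text \<open>The first alternative gives the codegrees of the join of a complete graph with \<open>s\<close> isolated
vertices (the set \<open>A\<close>) and a clique (the set \<open>M - A\<close>). The second gives those of the join of a
complete graph with four isolated vertices (the set \<open>M\<close>) from which one edge \<open>c z\<close> is deleted.\<close>

definition nearly_extremal :: "'a set set \<Rightarrow> 'a set \<Rightarrow> nat \<Rightarrow> nat \<Rightarrow> 'a set \<Rightarrow> 'a set \<Rightarrow> bool" where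
  "nearly_extremal E V m s A M \<longleftrightarrow> A \<subseteq> M \<and> M \<subseteq> V \<and> card A = s \<and> card M = m + 1 - s \<and>
     2 * s \<le> m \<and> (s = 2 \<or> (m, s) \<in> {(6, 3), (7, 3), (8, 4)}) \<and>
     ((\<forall>v\<in>A. codeg E V v = m - s) \<and> (\<forall>v\<in>M - A. codeg E V v = s) \<and> (\<forall>v\<in>V - M. codeg E V v = 0)
      \<or> m = 6 \<and> s = 3 \<and> (\<exists>c\<in>M. \<exists>z\<in>V - M. codeg E V c = 4 \<and> (\<forall>v\<in>M - {c}. codeg E V v = 3) \<and>
            codeg E V z = 1 \<and> (\<forall>v\<in>V - M - {z}. codeg E V v = 0)))"

text \<open>Compare the codegrees with the codegrees \<open>b\<close> of the join and let \<open>y\<close> be the excess. Cost is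
strictly increasing in the relevant range, so the cost bound limits the total excess: when the join
itself attains the bound, there is none. In the cases \<open>(6, 3)\<close> and \<open>(8, 4)\<close> the slack allows a total
of at most 2, and by parity it is 0 or 2. A total of 2 is only affordable if it is
distributed so that the squares of the codegrees are large, and the possible
distributions over \<open>M\<close> and its complement are excluded one by one, except for one
unit on each side when \<open>s = 3\<close>.\<close>

lemma nearly_extremal_of_cost_le:
  fixes E :: "'a set set"
  assumes fin: "finite V" and AM: "A \<subseteq> M" "M \<subseteq> V"
    and cA: "card A = s" and cM: "card M = m + 1 - s"
    and s: "2 \<le> s" "2 * s \<le> m" and q: "real m + 1 \<le> q"
    and xA: "\<And>v. v \<in> A \<Longrightarrow> m - s \<le> codeg E V v"
    and xM: "\<And>v. v \<in> M \<Longrightarrow> s \<le> codeg E V v"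
    and xV: "\<And>v. v \<in> V \<Longrightarrow> codeg E V v \<le> m - 2"
    and le: "(\<Sum>v\<in>V. cost q (codeg E V v)) \<le> cost_bound q m"
  shows "nearly_extremal E V m s A M"
proof -
  let ?x = "codeg E V"
  let ?exact = "(\<forall>v\<in>A. ?x v = m - s) \<and> (\<forall>v\<in>M - A. ?x v = s) \<and> (\<forall>v\<in>V - M. ?x v = 0)"
  let ?pendant = "m = 6 \<and> s = 3 \<and> (\<exists>c\<in>M. \<exists>z\<in>V - M. ?x c = 4 \<and> (\<forall>v\<in>M - {c}. ?x v = 3) \<and>
      ?x z = 1 \<and> (\<forall>v\<in>V - M - {z}. ?x v = 0))"
  define b where "b v = (if v \<in> A then m - s else if v \<in> M then s else 0)" for v
  define y where "y v = ?x v - b v" for v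
  have finM: "finite A" "finite M" using AM fin by (auto intro: finite_subset)
  have bx: "b v \<le> ?x v" for v using xA xM by (auto simp: b_def)
  then have xy: "?x v = b v + y v" for v by (simp add: y_def)
  have split: "sum f V = sum f A + sum f (M - A) + sum f (V - M)" for f :: "'a \<Rightarrow> 'b::comm_monoid_add"
    using sum.subset_diff[OF AM(2) fin, of f] sum.subset_diff[OF AM(1) finM(2), of f]
    by (simp add: ac_simps)
  define L where "L = real s * cost q (m - s) + real (m + 1 - 2 * s) * cost q s"
  have cMA: "card (M - A) = m + 1 - 2 * s" using AM finM cA cM by (simp add: card_Diff_subset)
  have sumb: "(\<Sum>v\<in>V. f (b v)) = real s * f (m - s) + real (m + 1 - 2 * s) * f s + (\<Sum>v\<in>V - M. f 0)"
    for f :: "nat \<Rightarrow> real"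
  proof -
    have "(\<Sum>v\<in>A. f (b v)) = (\<Sum>v\<in>A. f (m - s))" by (simp add: b_def)
    moreover have "(\<Sum>v\<in>M - A. f (b v)) = (\<Sum>v\<in>M - A. f s)" by (simp add: b_def)
    moreover have "(\<Sum>v\<in>V - M. f (b v)) = (\<Sum>v\<in>V - M. f 0)"
      using AM by (intro sum.cong) (auto simp: b_def)
    ultimately show ?thesis unfolding split[of "\<lambda>v. f (b v)"] by (simp add: cA cMA)
  qed
  have Lb: "(\<Sum>v\<in>V. cost q (b v)) = L" unfolding sumb L_def by (simp add: cost_def)
  have step: "real (y v) * (3 * q - 2 * (real m - 2)) \<le> cost q (?x v) - cost q (b v)" if "v \<in> V" for v
    using cost_diff_ge[OF bx[of v] xV[OF that], of q] s by (simp add: y_def bx of_nat_diff)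
  have pos: "0 < 3 * q - 2 * (real m - 2)" using q by (simp add: algebra_simps)
  have diff: "(\<Sum>v\<in>V. cost q (?x v) - cost q (b v)) \<le> cost_bound q m - L"
    using le Lb by (simp add: sum_subtractf)
  have nonneg: "0 \<le> cost q (?x v) - cost q (b v)" if "v \<in> V" for v
  proof -
    have "0 \<le> real (y v) * (3 * q - 2 * (real m - 2))"
      using pos by (intro mult_nonneg_nonneg) simp_all
    then show ?thesis using step[OF that] by linarith
  qed
  have "L \<le> cost_bound q m" using diff sum_nonneg[OF nonneg] by fastforce
  then have ms: "s = 2 \<or> (m, s) \<in> {(6, 3), (7, 3), (8, 4)}"
    using extremal_cost_le_bound[OF _ s(2) q] s unfolding L_def by fastforce
  have exact: ?exact if "\<And>v. v \<in> V \<Longrightarrow> y v = 0"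
  proof -
    have "?x v = b v" if "v \<in> V" for v using that \<open>\<And>v. v \<in> V \<Longrightarrow> y v = 0\<close> xy[of v] by simp
    then show ?thesis using AM by (auto simp: b_def)
  qed
  have D: "real (sum y V) * (3 * q - 2 * (real m - 2)) \<le> cost_bound q m - L"
    using order_trans[OF sum_mono[OF step] diff] by (simp add: sum_distrib_right)
  consider "s = 2 \<or> (m, s) = (7, 3)" | "(m, s) = (6, 3) \<or> (m, s) = (8, 4)" using ms by auto
  then have "?exact \<or> ?pendant"
  proof cases
    case 1
    then have "cost_bound q m - L = 0"
      using extremal_cost_minus_bound[OF s(2), of q] unfolding L_def by (auto simp: power2_eq_square)
    then have "real (sum y V) \<le> 0" using D pos by (simp add: mult_le_0_iff)
    then have "sum y V = 0" by (simp del: of_nat_sum)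
    then show ?thesis using exact fin by simp
  next
    case 2
    then have m: "m = 2 * s" "s = 3 \<or> s = 4" by auto
    \<comment> \<open>The slack between the join and the bound, linear in \<open>q\<close>; three units of excess cost more.\<close>
    have CL: "cost_bound q m - L = (if s = 3 then 6 * q - 8 else 6 * q - 12)"
      using extremal_cost_minus_bound[OF s(2), of q] 2 unfolding L_def by (auto simp: power2_eq_square)
    have D2: "sum y V \<le> 2"
    proof (rule ccontr)
      assume "\<not> sum y V \<le> 2"
      then have "3 * (3 * q - 2 * (real m - 2)) \<le> real (sum y V) * (3 * q - 2 * (real m - 2))"
        using pos by (intro mult_right_mono) (simp_all del: of_nat_sum)
      then have "3 * (3 * q - 2 * (real m - 2)) \<le> cost_bound q m - L" using D by linarith
      then show False using CL q 2 by auto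
    qed
    have bM: "b v = s" if "v \<in> M" for v using that m by (auto simp: b_def)
    have bV: "b v = 0" if "v \<in> V - M" for v using that AM by (auto simp: b_def)
    have split2: "sum f V = sum f M + sum f (V - M)" for f :: "'a \<Rightarrow> nat"
      using sum.subset_diff[OF AM(2) fin, of f] by simp
    have "sum b V = s * (s + 1)" unfolding split2 using bM bV cM m by simp
    moreover have "sum ?x V = sum b V + sum y V" by (simp add: xy sum.distrib)
    ultimately have "even (sum y V)" using sum_codeg_even[OF fin, of E] by auto
    then consider "sum y V = 0" | "sum y V = 2" using D2
      by (metis One_nat_def even_Suc even_zero le_Suc_eq le_zero_eq numeral_2_eq_2)
    then show ?thesis
    proof cases
      case 1
      then show ?thesis using exact fin by simp
    next
      case y2: 2
      \<comment> \<open>With total excess 2 the linear part of the extra cost is \<open>6 * q\<close>, so the squares have to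
        compensate for the constants 8 and 12 in the slack.\<close>
      have xb: "cost q (?x v) - cost q (b v) = 3 * q * real (y v) - real ((y v)\<^sup>2 + 2 * b v * y v)" for v
        unfolding xy cost_def by (simp add: algebra_simps power2_eq_square)
      have "(\<Sum>v\<in>V. cost q (?x v) - cost q (b v)) = 6 * q - real (\<Sum>v\<in>V. (y v)\<^sup>2 + 2 * b v * y v)"
        using y2 unfolding xb sum_subtractf of_nat_sum
        by (simp flip: sum_distrib_left of_nat_sum)
      then have "real (\<Sum>v\<in>V. (y v)\<^sup>2 + 2 * b v * y v) \<ge> (if s = 3 then 8 else 12)"
        using diff CL by (auto split: if_splits)
      then have big: "(\<Sum>v\<in>V. (y v)\<^sup>2 + 2 * b v * y v) \<ge> (if s = 3 then 8 else 12)"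
        by (auto split: if_splits simp del: of_nat_sum)
      have "(\<Sum>v\<in>V. 2 * b v * y v) = 2 * s * sum y M"
        unfolding split2 using bM bV by (simp add: sum_distrib_left)
      then have big': "(if s = 3 then 8 else 12) \<le> (\<Sum>v\<in>V. (y v)\<^sup>2) + 2 * s * sum y M"
        using big by (simp add: sum.distrib)
      have yM: "sum y M + sum y (V - M) = 2" using y2 split2[of y] by simp
      then consider "sum y M = 0" | "sum y M = 1" "sum y (V - M) = 1" | "sum y M = 2" "sum y (V - M) = 0"
        by linarith
      then show ?thesis
      proof cases
        case 1
        have "y v \<le> 2" if "v \<in> V" for v using member_le_sum[OF that, of y] y2 fin by simp
        then have "(\<Sum>v\<in>V. (y v)\<^sup>2) \<le> (\<Sum>v\<in>V. 2 * y v)"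
          by (intro sum_mono) (simp add: power2_eq_square)
        also have "\<dots> = 4" using y2 by (simp flip: sum_distrib_left)
        finally show ?thesis using big' 1 by (auto split: if_splits)
      next
        case 2
        obtain c where c: "c \<in> M" "y c = 1" "\<And>v. v \<in> M \<Longrightarrow> v \<noteq> c \<Longrightarrow> y v = 0"
          using 2(1) finM sum_eq_1_iff[of M y] by auto
        obtain z where z: "z \<in> V - M" "y z = 1" "\<And>v. v \<in> V - M \<Longrightarrow> v \<noteq> z \<Longrightarrow> y v = 0"
          using 2(2) fin sum_eq_1_iff[of "V - M" y] by auto
        have "y v \<le> 1" if "v \<in> V" for v
          using c z that by (cases "v \<in> M"; cases "v = c"; cases "v = z") auto
        then have "(y v)\<^sup>2 \<le> y v" if "v \<in> V" for v
          using that by (simp add: power2_eq_square)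
        then have "(\<Sum>v\<in>V. (y v)\<^sup>2) \<le> sum y V" by (intro sum_mono)
        then have "s = 3" using big' 2 y2 m(2) by (auto split: if_splits)
        moreover from this have "m = 6" using m by simp
        moreover have "?x c = 4" "?x z = 1" using c z bM bV xy \<open>s = 3\<close> by auto
        moreover have "\<forall>v\<in>M - {c}. ?x v = 3" "\<forall>v\<in>V - M - {z}. ?x v = 0"
          using c z bM bV xy \<open>s = 3\<close> by auto
        ultimately show ?thesis using c(1) z(1) by blast
      next
        case 3
        \<comment> \<open>All vertices outside \<open>M\<close> are joined to everything, so a vertex of \<open>M\<close> has its non-neighbours
          among the \<open>s\<close> other vertices of \<open>M\<close>.\<close>
        then have "y v = 0" if "v \<in> V - M" for v using that fin by simp
        then have full: "?x v = 0" if "v \<in> V - M" for v using that xy[of v] bV by simp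
        have "?x v \<le> s" if v: "v \<in> M" for v
        proof -
          have "{u \<in> V. u \<noteq> v \<and> {v, u} \<notin> E} \<subseteq> M - {v}"
          proof
            fix u assume u: "u \<in> {u \<in> V. u \<noteq> v \<and> {v, u} \<notin> E}"
            have "u \<in> M"
            proof (rule ccontr)
              assume "u \<notin> M"
              then have "?x u = 0" using full u by simp
              moreover have "v \<in> {w \<in> V. w \<noteq> u \<and> {u, w} \<notin> E}"
                using u v AM by (auto simp: insert_commute)
              ultimately show False using fin by (auto simp: codeg_def)
            qed
            then show "u \<in> M - {v}" using u by simp
          qed
          then have "?x v \<le> card (M - {v})" unfolding codeg_def using finM by (intro card_mono) auto
          then show ?thesis using v finM cM m by simp
        qed
        then have "y v = 0" if "v \<in> M" for v using that bM xy[of v] by fastforce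
        then show ?thesis using 3(1) by simp
      qed
    qed
  qed
  then show ?thesis unfolding nearly_extremal_def using AM cA cM s(2) ms by blast
qed

lemma nearly_extremal_codeg_le:
  assumes "nearly_extremal E V m s A M" "v \<in> V - M"
  shows "codeg E V v \<le> 1"
proof -
  from assms(1) consider "\<forall>v\<in>V - M. codeg E V v = 0"
    | z where "codeg E V z = 1" "\<forall>v\<in>V - M - {z}. codeg E V v = 0"
    unfolding nearly_extremal_def by blast
  then show ?thesis
  proof cases
    case (2 z)
    then show ?thesis using assms(2) by (cases "v = z") auto
  qed (use assms(2) in auto)
qed

lemma nearly_extremal_codeg_ge:
  assumes "nearly_extremal E V m s A M" "v \<in> M" "4 \<le> m"
  shows "2 \<le> codeg E V v"
proof -
  have s: "2 \<le> s" "2 \<le> m - s" using assms unfolding nearly_extremal_def by auto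
  from assms(1) consider "\<forall>v\<in>A. codeg E V v = m - s" "\<forall>v\<in>M - A. codeg E V v = s"
    | c where "codeg E V c = 4" "\<forall>v\<in>M - {c}. codeg E V v = 3"
    unfolding nearly_extremal_def by blast
  then show ?thesis
  proof cases
    case 1
    then show ?thesis using assms(2) s by (cases "v \<in> A") auto
  next
    case (2 c)
    then show ?thesis using assms(2) by (cases "v = c") auto
  qed
qed

text \<open>The vertices outside \<open>M\<close> are joined to everything, so non-neighbours of vertices of \<open>M\<close> lie in \<open>M\<close>.
A vertex of \<open>A\<close> has as many as there are other vertices in \<open>M\<close>; a vertex of \<open>M - A\<close> is therefore
nonadjacent to all of \<open>A\<close>, which already uses up its codegree.\<close>

lemma nonadjacent_of_extremal_codeg:
  assumes fin: "finite V" and AM: "A \<subseteq> M" "M \<subseteq> V"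
    and cA: "card A = s" and cM: "card M = m + 1 - s"
    and xA: "\<forall>v\<in>A. codeg E V v = m - s"
    and xM: "\<forall>v\<in>M - A. codeg E V v = s"
    and x0: "\<forall>v\<in>V - M. codeg E V v = 0"
    and uv: "u \<in> V" "v \<in> V" "u \<noteq> v"
  shows "{u, v} \<notin> E \<longleftrightarrow> u \<in> M \<and> v \<in> M \<and> (u \<in> A \<or> v \<in> A)"
proof -
  define N where "N v = {u \<in> V. u \<noteq> v \<and> {v, u} \<notin> E}" for v
  have sym: "a \<in> N b \<Longrightarrow> b \<in> V \<Longrightarrow> b \<in> N a" for a b by (auto simp: N_def insert_commute)
  have finM: "finite A" "finite M" using AM fin by (auto intro: finite_subset)
  have cN: "codeg E V v = card (N v)" for v by (simp add: N_def codeg_def)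
  have finN: "finite (N v)" for v using fin by (simp add: N_def)
  have N0: "N v = {}" if "v \<in> V - M" for v using x0 that cN finN by simp
  have NM: "N v \<subseteq> M - {v}" if "v \<in> M" for v
  proof
    fix u assume u: "u \<in> N v"
    then have "v \<in> N u" using sym that AM by blast
    then have "u \<notin> V - M" using N0 by blast
    then show "u \<in> M - {v}" using u by (auto simp: N_def)
  qed
  have NA: "N v = M - {v}" if "v \<in> A" for v
  proof (rule card_subset_eq)
    show "card (N v) = card (M - {v})" using that AM cM xA cN[of v] finM by auto
  qed (use NM that AM finM in auto)
  have NC: "N v = A" if "v \<in> M - A" for v
  proof (rule card_subset_eq[symmetric])
    show "card A = card (N v)" using that xM cN[of v] cA by auto
    show "A \<subseteq> N v" using NA sym that AM by blast
  qed (use finN in auto)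
  have "{u, v} \<notin> E \<longleftrightarrow> v \<in> N u" using uv by (auto simp: N_def)
  also have "\<dots> \<longleftrightarrow> u \<in> M \<and> v \<in> M \<and> (u \<in> A \<or> v \<in> A)"
    using N0[of u] NA[of u] NC[of u] uv AM by auto
  finally show ?thesis .
qed

text \<open>Only vertices of \<open>M\<close> and \<open>z\<close> have non-neighbours. The vertex \<open>c\<close> needs all four other
candidates, so the single non-neighbour of \<open>z\<close> is \<open>c\<close>, and the remaining vertices of \<open>M\<close> have to be
nonadjacent to all of \<open>M\<close>.\<close>

lemma nonadjacent_of_pendant_codeg:
  assumes fin: "finite V" and MV: "M \<subseteq> V" and cM: "card M = 4"
    and c: "c \<in> M" "codeg E V c = 4" and z: "z \<in> V - M" "codeg E V z = 1"
    and xM: "\<forall>v\<in>M - {c}. codeg E V v = 3"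
    and x0: "\<forall>v\<in>V - M - {z}. codeg E V v = 0"
    and uv: "u \<in> V" "v \<in> V" "u \<noteq> v"
  shows "{u, v} \<notin> E \<longleftrightarrow> u \<in> M \<and> v \<in> M \<or> {u, v} = {c, z}"
proof -
  define N where "N v = {u \<in> V. u \<noteq> v \<and> {v, u} \<notin> E}" for v
  have sym: "a \<in> N b \<Longrightarrow> b \<in> V \<Longrightarrow> b \<in> N a" for a b by (auto simp: N_def insert_commute)
  have finM: "finite M" using MV fin by (auto intro: finite_subset)
  have cN: "codeg E V v = card (N v)" for v by (simp add: N_def codeg_def)
  have finN: "finite (N v)" for v using fin by (simp add: N_def)
  have N0: "N v = {}" if "v \<in> V - M - {z}" for v using x0 that cN finN by simp
  have Nin: "N v \<subseteq> insert z M - {v}" if "v \<in> V" for v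
  proof
    fix u assume u: "u \<in> N v"
    then have "v \<in> N u" using sym that by blast
    then have "u \<notin> V - M - {z}" using N0 by blast
    then show "u \<in> insert z M - {v}" using u by (auto simp: N_def)
  qed
  have Nc: "N c = insert z M - {c}"
  proof (rule card_subset_eq)
    show "card (N c) = card (insert z M - {c})" using c z cM finM cN[of c] by auto
  qed (use Nin[of c] MV c finM in auto)
  have Nz: "N z = {c}"
  proof (rule card_subset_eq[symmetric])
    show "card {c} = card (N z)" using z cN[of z] by simp
    show "{c} \<subseteq> N z" using Nc sym[of z c] MV c z by auto
  qed (use finN in auto)
  have NM: "N v = M - {v}" if "v \<in> M - {c}" for v
  proof (rule card_subset_eq)
    show "card (N v) = card (M - {v})" using that xM cM cN[of v] finM by auto
    have "v \<notin> N z" using Nz that by auto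
    then have "z \<notin> N v" using sym[of z v] that MV by blast
    then show "N v \<subseteq> M - {v}" using Nin[of v] that MV by auto
  qed (use finM in auto)
  have "{u, v} \<notin> E \<longleftrightarrow> v \<in> N u" using uv by (auto simp: N_def)
  also have "\<dots> \<longleftrightarrow> u \<in> M \<and> v \<in> M \<or> {u, v} = {c, z}"
    using N0[of u] Nz Nc NM[of u] uv MV c z by (cases "u = c"; cases "u = z"; cases "u \<in> M") (auto simp: doubleton_eq_iff)
  finally show ?thesis .
qed

section \<open>Reciprocal degree distance and codegrees\<close>

lemma simple_graph_no_loop: "simple_graph G \<Longrightarrow> {x} \<notin> edges G"
  unfolding simple_graph_def by (metis card.empty card_insert_disjoint empty_iff finite.emptyI
      n_not_Suc_n numeral_2_eq_2 One_nat_def)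

lemma vdegree_plus_codeg:
  assumes "simple_graph G" "v \<in> verts G"
  shows "codeg (edges G) (verts G) v + vdegree G v = graph_order G - 1"
  using codeg_plus_degree[of "verts G" v "edges G"] assms simple_graph_no_loop[OF assms(1)]
  by (simp add: vdegree_def simple_graph_def)

lemma inverse_distance_le:
  assumes "connected_graph G" "u \<in> verts G" "v \<in> verts G" "u \<noteq> v"
  shows "1 / real (distance G u v) \<le> (if {u, v} \<in> edges G then 1 else 1 / 2)"
proof -
  obtain p where p: "is_path G u p v" using assms by (auto simp: connected_graph_def)
  then have "\<exists>m p. is_path G u p v \<and> length p = Suc m"
    by (metis is_path_def length_0_conv not0_implies_Suc)
  then have "\<exists>p. is_path G u p v \<and> length p = Suc (distance G u v)"
    unfolding distance_def by (rule LeastI_ex)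
  then obtain p where p: "is_path G u p v" "length p = Suc (distance G u v)" by blast
  have "distance G u v \<noteq> 0"
  proof
    assume "distance G u v = 0"
    then obtain x where "p = [x]" using p(2) by (auto simp: length_Suc_conv)
    then show False using p(1) assms(4) by (auto simp: is_path_def)
  qed
  moreover have "{u, v} \<in> edges G" if "distance G u v = 1"
  proof -
    from that p(2) obtain x y where "p = [x, y]" by (auto simp: length_Suc_conv)
    then show ?thesis using p(1) by (auto simp: is_path_def)
  qed
  ultimately have "1 \<le> distance G u v" "{u, v} \<notin> edges G \<longrightarrow> 2 \<le> distance G u v" by linarith+
  then show ?thesis by (auto simp: divide_simps)
qed

text \<open>A vertex of degree \<open>d\<close> and codegree \<open>x\<close> has \<open>d\<close> vertices at distance 1 and \<open>x\<close> vertices at distance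
at least 2, so its sum of reciprocal distances is at most \<open>d + x / 2\<close>.\<close>

lemma RDD_le_codeg:
  assumes G: "simple_graph G" "connected_graph G" and n: "graph_order G = n"
  shows "RDD G \<le> real n * (real n - 1)\<^sup>2 - (\<Sum>v\<in>verts G. cost (real n - 1) (codeg (edges G) (verts G) v)) / 2"
proof -
  let ?V = "verts G" and ?x = "codeg (edges G) (verts G)"
  have fin: "finite ?V" using G by (simp add: simple_graph_def)
  have "?V \<noteq> {}" using G by (simp add: connected_graph_def)
  then have n1: "1 \<le> n" using fin n by (metis One_nat_def Suc_leI card_gt_0_iff)
  have vertex: "real (vdegree G v) * (\<Sum>u\<in>?V - {v}. 1 / real (distance G v u))
      \<le> (real n - 1)\<^sup>2 - cost (real n - 1) (?x v) / 2" if v: "v \<in> ?V" for v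
  proof -
    let ?N = "{u \<in> ?V. {v, u} \<in> edges G}" and ?O = "{u \<in> ?V. u \<noteq> v \<and> {v, u} \<notin> edges G}"
    have dx: "real (?x v) + real (vdegree G v) = real n - 1"
      using vdegree_plus_codeg[OF G(1) v] n n1 by (simp flip: of_nat_add add: of_nat_diff)
    have V: "?V - {v} = ?N \<union> ?O" using simple_graph_no_loop[OF G(1)] by auto
    have "(\<Sum>u\<in>?V - {v}. 1 / real (distance G v u))
        \<le> (\<Sum>u\<in>?V - {v}. if {v, u} \<in> edges G then 1 else 1 / 2)"
      by (intro sum_mono inverse_distance_le[OF G(2) v]) auto
    also have "\<dots> = (\<Sum>u\<in>?N. 1) + (\<Sum>u\<in>?O. 1 / 2)"
      unfolding V using fin by (subst sum.union_disjoint) (auto intro!: arg_cong2[of _ _ _ _ "(+)"] sum.cong)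
    also have "\<dots> = real (vdegree G v) + real (?x v) / 2" by (simp add: vdegree_def codeg_def)
    finally have "real (vdegree G v) * (\<Sum>u\<in>?V - {v}. 1 / real (distance G v u))
        \<le> real (vdegree G v) * (real (vdegree G v) + real (?x v) / 2)"
      by (intro mult_left_mono) auto
    also have "\<dots> = (real n - 1)\<^sup>2 - cost (real n - 1) (?x v) / 2"
      unfolding dx[symmetric] cost_def by (simp add: field_simps power2_eq_square)
    finally show ?thesis .
  qed
  have "RDD G \<le> (\<Sum>v\<in>?V. (real n - 1)\<^sup>2 - cost (real n - 1) (?x v) / 2)"
    unfolding RDD_eq_sum_degree[OF fin] by (intro sum_mono vertex)
  then show ?thesis by (simp add: sum_subtractf n sum_divide_distrib)
qed

lemma cost_le_bound_of_RDD:
  assumes G: "simple_graph G" "connected_graph G" and n: "graph_order G = m + k"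
    and R: "RDD G \<ge> real (m + k) ^ 3 - 7 * real (m + k) ^ 2 + (20 + 4 * real k) * real (m + k)
                  + real k ^ 2 - 4 * real k - 17"
  shows "(\<Sum>v\<in>verts G. cost (real (m + k) - 1) (codeg (edges G) (verts G) v))
    \<le> cost_bound (real (m + k) - 1) m"
proof -
  have "real (m + k) ^ 3 - 7 * real (m + k) ^ 2 + (20 + 4 * real k) * real (m + k)
      + real k ^ 2 - 4 * real k - 17
    = real (m + k) * (real (m + k) - 1)\<^sup>2 - cost_bound (real (m + k) - 1) m / 2"
    unfolding cost_bound_def by (simp add: field_simps power2_eq_square power3_eq_cube)
  then show ?thesis using RDD_le_codeg[OF G n] R by linarith
qed

section \<open>Spanning trees with prescribed leaves\<close>

definition add_pendant :: "'a ugraph \<Rightarrow> 'a \<Rightarrow> 'a \<Rightarrow> 'a ugraph" where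
  "add_pendant T u v = \<lparr>verts = insert v (verts T), edges = insert {u, v} (edges T)\<rparr>"

lemma tree_single: "tree \<lparr>verts = {x}, edges = {}\<rparr>"
proof -
  let ?T = "\<lparr>verts = {x}, edges = {}\<rparr>"
  have "is_path ?T x [x] x" by (simp add: is_path_def)
  then show ?thesis
    by (auto simp: tree_def simple_graph_def connected_graph_def acyclic_graph_def)
qed

text \<open>A cycle in the new graph cannot avoid \<open>v\<close>, and if it contains \<open>v\<close>, then both its neighbours on
the cycle equal \<open>u\<close>. A cycle is given by a path \<open>p\<close> together with an edge between its ends, so the
vertex \<open>v\<close> may be at either end of \<open>p\<close> or inside.\<close>

lemma tree_add_pendant:
  assumes T: "tree T" and u: "u \<in> verts T" and v: "v \<notin> verts T"
  shows "tree (add_pendant T u v)"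
proof -
  let ?T = "add_pendant T u v"
  have sT: "simple_graph T" and cT: "connected_graph T" and aT: "acyclic_graph T"
    using T by (auto simp: tree_def)
  have uv: "u \<noteq> v" using u v by auto
  have vE: "e \<in> edges T \<Longrightarrow> v \<notin> e" for e using sT v by (auto simp: simple_graph_def)
  have nb: "{x, v} \<in> edges ?T \<Longrightarrow> x = u" "{v, x} \<in> edges ?T \<Longrightarrow> x = u" for x
    using vE[of "{x, v}"] vE[of "{v, x}"] uv
    by (auto simp: add_pendant_def doubleton_eq_iff)
  have s: "simple_graph ?T" using sT u uv by (auto simp: simple_graph_def add_pendant_def)
  have lift: "is_path ?T a p b" if "is_path T a p b" for a p b
    using that by (auto simp: is_path_def add_pendant_def)
  have tov: "is_path ?T a (p @ [v]) v" if p: "is_path T a p u" for a p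
    unfolding is_path_def
  proof (intro conjI allI impI)
    fix i assume "Suc i < length (p @ [v])"
    then consider "Suc i < length p" | "Suc i = length p" by fastforce
    then show "{(p @ [v]) ! i, (p @ [v]) ! Suc i} \<in> edges ?T"
    proof cases
      case 2
      then have "i = length p - 1" by simp
      then have "p ! i = u" using p unfolding is_path_def by (metis last_conv_nth)
      then show ?thesis using 2 by (simp add: nth_append add_pendant_def)
    qed (use p in \<open>auto simp: nth_append is_path_def add_pendant_def\<close>)
  qed (use p v in \<open>auto simp: is_path_def add_pendant_def\<close>)
  have "\<exists>p. is_path ?T a p b" if ab: "a \<in> verts ?T" "b \<in> verts ?T" for a b
  proof -
    have vv: "is_path ?T v [v] v" by (simp add: is_path_def add_pendant_def)
    have *: "\<exists>p. is_path ?T a p v" if "a \<in> verts T" for a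
      using that u cT tov by (meson connected_graph_def)
    consider "a \<in> verts T" "b \<in> verts T" | "a = v" "b = v" | "a = v" "b \<in> verts T" | "a \<in> verts T" "b = v"
      using ab by (auto simp: add_pendant_def)
    then show ?thesis
    proof cases
      case 1
      then show ?thesis using cT lift by (meson connected_graph_def)
    next
      case 3
      then show ?thesis using * is_path_rev by metis
    qed (use vv * in auto)
  qed
  then have c: "connected_graph ?T" by (auto simp: connected_graph_def add_pendant_def)
  have "False" if p: "is_path ?T a p b" "3 \<le> length p" and ba: "{b, a} \<in> edges ?T" for a b p
  proof (cases "v \<in> set p")
    case False
    have inT: "{x, y} \<in> edges T" if "{x, y} \<in> edges ?T" "x \<in> set p" "y \<in> set p" for x y
      using that False by (auto simp: add_pendant_def doubleton_eq_iff)
    have ab: "a \<in> set p" "b \<in> set p" using p(1) by (auto simp: is_path_def)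
    have "is_path T a p b" unfolding is_path_def
    proof (intro conjI allI impI)
      fix i assume "Suc i < length p"
      then show "{p ! i, p ! Suc i} \<in> edges T" using p(1) inT by (auto simp: is_path_def)
    qed (use p(1) False in \<open>auto simp: is_path_def add_pendant_def\<close>)
    moreover have "{b, a} \<in> edges T" using inT ba ab by blast
    ultimately show False using aT p(2) unfolding acyclic_graph_def by blast
  next
    case True
    then obtain i where i: "i < length p" "p ! i = v" by (auto simp: in_set_conv_nth)
    have d: "distinct p" "p \<noteq> []" and e: "\<And>i. Suc i < length p \<Longrightarrow> {p ! i, p ! Suc i} \<in> edges ?T"
      and hl: "p ! 0 = a" "p ! (length p - 1) = b"
      using p(1) by (auto simp: is_path_def hd_conv_nth last_conv_nth)
    consider "i = 0" | "i = length p - 1" "i \<noteq> 0" | "0 < i" "Suc i < length p" using i(1) by linarith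
    then show False
    proof cases
      case 1
      then have "p ! Suc 0 = u" "p ! (length p - 1) = u" using e[of 0] i hl nb ba p(2) by auto
      then have "Suc 0 = length p - 1" using d p(2) by (subst nth_eq_iff_index_eq[symmetric]) auto
      then show False using p(2) by simp
    next
      case 2
      have "Suc (length p - 2) = length p - 1" using p(2) by simp
      then have "{p ! (length p - 2), v} \<in> edges ?T" "{v, p ! 0} \<in> edges ?T"
        using e[of "length p - 2"] 2 i hl ba by auto
      then have "p ! (length p - 2) = u" "p ! 0 = u" using nb by blast+
      then have "length p - 2 = 0" using d p(2) by (subst nth_eq_iff_index_eq[symmetric]) auto
      then show False using p(2) by simp
    next
      case 3
      then have "p ! (i - 1) = u" "p ! Suc i = u" using e[of "i - 1"] e[of i] i nb by auto
      then have "i - 1 = Suc i" using d 3 by (subst nth_eq_iff_index_eq[symmetric]) auto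
      then show False by simp
    qed
  qed
  then have "acyclic_graph ?T" unfolding acyclic_graph_def by blast
  then show ?thesis using s c by (simp add: tree_def)
qed

lemma vdegree_add_pendant:
  assumes T: "simple_graph T" and u: "u \<in> verts T" and v: "v \<notin> verts T"
    and w: "w \<in> insert v (verts T)"
  shows "vdegree (add_pendant T u v) w =
    (if w = v then 1 else if w = u then Suc (vdegree T u) else vdegree T w)"
proof -
  have uv: "u \<noteq> v" using u v by auto
  have fin: "finite (verts T)" using T by (simp add: simple_graph_def)
  have vE: "{v, x} \<notin> edges T" "{x, v} \<notin> edges T" for x using T v by (auto simp: simple_graph_def)
  have "{x \<in> insert v (verts T). {w, x} \<in> insert {u, v} (edges T)} =
    (if w = v then {u} else if w = u then insert v {x \<in> verts T. {u, x} \<in> edges T}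
      else {x \<in> verts T. {w, x} \<in> edges T})"
    using uv vE u v by (auto simp: doubleton_eq_iff)
  then show ?thesis using fin v by (simp add: vdegree_def add_pendant_def)
qed

text \<open>Excluding vertices of degree 0 excludes the one-vertex tree. So a vertex that is not in \<open>S\<close> has
degree at least 2 in the tree, and new leaves can be attached to it without further change.\<close>

definition leaf_tree :: "'a set set \<Rightarrow> 'a set \<Rightarrow> 'a set \<Rightarrow> bool" where
  "leaf_tree E U S \<longleftrightarrow> (\<exists>T. tree T \<and> verts T = U \<and> edges T \<subseteq> E \<and> leaves T = S \<and>
     (\<forall>v\<in>U. vdegree T v \<noteq> 0))"

lemma leaf_tree_edge:
  assumes "{u, v} \<in> E" "u \<noteq> v"
  shows "leaf_tree E {u, v} {u, v}"
proof -
  let ?K = "\<lparr>verts = {u}, edges = {}\<rparr>"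
  let ?T = "add_pendant ?K u v"
  have d: "vdegree ?T w = 1" if "w \<in> {u, v}" for w
  proof -
    have "simple_graph ?K" "vdegree ?K u = 0" by (simp_all add: simple_graph_def vdegree_def)
    then show ?thesis using vdegree_add_pendant[of ?K u v w] that assms by auto
  qed
  have "tree ?T" by (rule tree_add_pendant[OF tree_single]) (use assms in auto)
  then show ?thesis unfolding leaf_tree_def
    by (intro exI[of _ ?T]) (use d assms in \<open>auto simp: leaves_def add_pendant_def\<close>)
qed

lemma leaf_tree_add:
  assumes "leaf_tree E U S" "u \<in> U" "v \<notin> U" "{u, v} \<in> E"
  shows "leaf_tree E (insert v U) (insert v (S - {u}))"
proof -
  obtain T where T: "tree T" "verts T = U" "edges T \<subseteq> E" "leaves T = S" "\<forall>v\<in>U. vdegree T v \<noteq> 0"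
    using assms(1) by (auto simp: leaf_tree_def)
  let ?T = "add_pendant T u v"
  have sT: "simple_graph T" using T(1) by (simp add: tree_def)
  have d: "vdegree ?T w = (if w = v then 1 else if w = u then Suc (vdegree T u) else vdegree T w)"
    if "w \<in> insert v U" for w
    using vdegree_add_pendant[OF sT] assms T(2) that by simp
  have v: "verts ?T = insert v U" "edges ?T \<subseteq> E" using T assms by (auto simp: add_pendant_def)
  have "leaves ?T = insert v (S - {u})"
    using T(4,5) assms(2,3) d unfolding leaves_def v(1) T(2) by (auto split: if_splits)
  moreover have "\<forall>w\<in>insert v U. vdegree ?T w \<noteq> 0" using d T(5) by auto
  moreover have "tree ?T" using tree_add_pendant T(1,2) assms by metis
  ultimately show ?thesis unfolding leaf_tree_def using v by blast
qed

lemma leaf_tree_extend: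
  assumes "leaf_tree E U S" "u \<in> U" "u \<in> S"
    and "successively (\<lambda>x y. {x, y} \<in> E) (u # xs)" "distinct xs" "set xs \<inter> U = {}"
  shows "leaf_tree E (U \<union> set xs) (insert (last (u # xs)) (S - {u}))"
  using assms
proof (induction xs arbitrary: u U S)
  case (Cons x xs)
  have x: "x \<notin> U" "{u, x} \<in> E" using Cons.prems by auto
  have "leaf_tree E (insert x U \<union> set xs) (insert (last (x # xs)) (insert x (S - {u}) - {x}))"
  proof (rule Cons.IH)
    show "leaf_tree E (insert x U) (insert x (S - {u}))"
      using leaf_tree_add[OF Cons.prems(1,2) x] .
  qed (use Cons.prems in auto)
  moreover have "x \<notin> S" using Cons.prems(1) x(1) by (auto simp: leaf_tree_def leaves_def)
  ultimately show ?case by (simp add: insert_commute)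
qed (simp add: insert_absorb)

lemma leaf_tree_path:
  assumes "successively (\<lambda>x y. {x, y} \<in> E) p" "distinct p" "p \<noteq> []" "hd p \<noteq> last p"
  shows "leaf_tree E (set p) {hd p, last p}"
proof -
  obtain x y xs where p: "p = x # y # xs"
  proof (cases p)
    case (Cons x q)
    then show ?thesis using that assms(4) by (cases q) auto
  qed (use assms in auto)
  have "leaf_tree E {x, y} {x, y}" using leaf_tree_edge assms p by auto
  from leaf_tree_extend[OF this, of y xs]
  have "leaf_tree E ({x, y} \<union> set xs) (insert (last (y # xs)) ({x, y} - {y}))"
    using assms p by auto
  moreover have "{x, y} - {y} = {x}" using assms p by auto
  ultimately show ?thesis using p by (simp add: insert_commute Un_commute)
qed

text \<open>Every new vertex is attached to a vertex that is no leaf and that stays no leaf.\<close>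

lemma leaf_tree_attach:
  assumes "finite R" "leaf_tree E U S" "R \<inter> U = {}" "\<forall>r\<in>R. \<exists>u\<in>U - S. {u, r} \<in> E"
  shows "leaf_tree E (U \<union> R) (S \<union> R)"
  using assms
proof (induction R)
  case (insert r R)
  obtain u where u: "u \<in> U - S" "{u, r} \<in> E" using insert.prems by auto
  have "leaf_tree E (U \<union> R) (S \<union> R)" using insert by auto
  from leaf_tree_add[OF this, of u r]
  have "leaf_tree E (insert r (U \<union> R)) (insert r (S \<union> R - {u}))"
    using u insert by auto
  moreover have "S \<union> R - {u} = S \<union> R" using u insert.prems by auto
  ultimately show ?case by simp
qed auto

text \<open>The backbone of the tree in \<open>leaf_tree_spider\<close>, without its ends.\<close>

lemma zigzag_path:
  assumes "length ws = length as" "distinct (a # as @ ws)"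
    and "\<forall>w\<in>set ws. \<forall>x\<in>insert a (set as). {x, w} \<in> E \<and> {w, x} \<in> E"
  shows "\<exists>p. p \<noteq> [] \<and> successively (\<lambda>x y. {x, y} \<in> E) p \<and> distinct p \<and>
    set p = insert a (set as \<union> set ws) \<and> hd p = a \<and> last p \<in> insert a (set as)"
  using assms
proof (induction ws as arbitrary: a rule: list_induct2)
  case Nil
  show ?case by (rule exI[of _ "[a]"]) auto
next
  case (Cons w ws b as)
  have "\<exists>p. p \<noteq> [] \<and> successively (\<lambda>x y. {x, y} \<in> E) p \<and> distinct p \<and>
    set p = insert b (set as \<union> set ws) \<and> hd p = b \<and> last p \<in> insert b (set as)"
    by (rule Cons.IH) (use Cons.prems in auto)
  then obtain p where p: "p \<noteq> []" "successively (\<lambda>x y. {x, y} \<in> E) p" "distinct p"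
    "set p = insert b (set as \<union> set ws)" "hd p = b" "last p \<in> insert b (set as)" by blast
  have "successively (\<lambda>x y. {x, y} \<in> E) (a # w # p)"
    using p Cons.prems by (cases p) auto
  then show ?case using p Cons.prems by (intro exI[of _ "a # w # p"]) auto
qed

text \<open>The tree consists of a path between two elements of \<open>S\<close> that alternates between \<open>A\<close> and \<open>W\<close>, of a
branch from \<open>w\<close> through the clique \<open>C\<close> to the third element \<open>s\<close> of \<open>S\<close>, and of the remaining
elements of \<open>S\<close> attached to \<open>w\<close>. The end of the branch is what a third element of \<open>S\<close> is needed for.\<close>

lemma leaf_tree_spider:
  assumes fin: "finite S" "finite W" "finite A" "finite C"
    and dis: "S \<inter> W = {}" "S \<inter> A = {}" "S \<inter> C = {}" "W \<inter> A = {}" "W \<inter> C = {}" "A \<inter> C = {}"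
    and card: "card A = card W + 1" "3 \<le> card S" "C \<noteq> {}"
    and SWA: "\<forall>x\<in>S \<union> W. \<forall>y\<in>A. {x, y} \<in> E"
    and CC: "\<forall>c\<in>C. \<forall>c'\<in>C. c \<noteq> c' \<longrightarrow> {c, c'} \<in> E"
    and w: "w \<in> W" "\<forall>c\<in>C \<union> S. {w, c} \<in> E"
    and s: "s \<in> S" "\<forall>c\<in>C. {c, s} \<in> E"
  shows "leaf_tree E (S \<union> W \<union> A \<union> C) S"
proof -
  have AE: "{x, y} \<in> E" "{y, x} \<in> E" if "x \<in> S \<union> W" "y \<in> A" for x y
    using SWA that by (auto simp: insert_commute)
  obtain ws where ws: "set ws = W" "distinct ws" using finite_distinct_list[OF fin(2)] by blast
  obtain as' where as': "set as' = A" "distinct as'" using finite_distinct_list[OF fin(3)] by blast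
  have len: "length as' = Suc (length ws)" using card(1) ws as' distinct_card[of ws] distinct_card[of as'] by simp
  then obtain a as where as: "as' = a # as" by (cases as') auto
  obtain p where p: "p \<noteq> []" "successively (\<lambda>x y. {x, y} \<in> E) p" "distinct p"
    "set p = A \<union> W" "hd p \<in> A" "last p \<in> A"
  proof -
    have "\<exists>p. p \<noteq> [] \<and> successively (\<lambda>x y. {x, y} \<in> E) p \<and> distinct p \<and>
      set p = insert a (set as \<union> set ws) \<and> hd p = a \<and> last p \<in> insert a (set as)"
    proof (rule zigzag_path)
      show "\<forall>w\<in>set ws. \<forall>x\<in>insert a (set as). {x, w} \<in> E \<and> {w, x} \<in> E"
        using AE as as'(1) ws(1) by auto
    qed (use len as as' ws dis(4) in auto)
    then show ?thesis using that as as'(1) ws(1) by auto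
  qed
  have "2 \<le> card (S - {s})" using card(2) s(1) fin by simp
  then obtain B where B: "B \<subseteq> S - {s}" "card B = 2" by (meson obtain_subset_with_card_n)
  then obtain s1 s2 where s12: "s1 \<noteq> s2" "B = {s1, s2}" by (auto simp: card_2_iff)
  have sS: "s1 \<in> S" "s2 \<in> S" "s1 \<noteq> s" "s2 \<noteq> s" using B s12 by auto
  have "successively (\<lambda>x y. {x, y} \<in> E) (s1 # p @ [s2])"
    using p(1,2,5,6) sS AE by (auto simp: successively_Cons successively_append_iff)
  moreover have "distinct (s1 # p @ [s2])" using p dis sS s12 by auto
  ultimately have "leaf_tree E (set (s1 # p @ [s2])) {s1, s2}"
    using leaf_tree_path[of E "s1 # p @ [s2]"] s12 by simp
  moreover have "set (s1 # p @ [s2]) = A \<union> W \<union> {s1, s2}" using p(4) by auto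
  ultimately have 1: "leaf_tree E (A \<union> W \<union> {s1, s2}) {s1, s2}" by simp
  obtain cs' where cs': "set cs' = C" "distinct cs'" using finite_distinct_list[OF fin(4)] by blast
  obtain c cs where cs: "cs' = c # cs" using cs' card(3) by (cases cs') auto
  have cC: "c \<in> C" using cs cs' by auto
  have 2: "leaf_tree E (insert c (A \<union> W \<union> {s1, s2})) (insert c {s1, s2})"
  proof -
    have "leaf_tree E (insert c (A \<union> W \<union> {s1, s2})) (insert c ({s1, s2} - {w}))"
      by (rule leaf_tree_add[OF 1]) (use w cC dis sS in auto)
    moreover have "{s1, s2} - {w} = {s1, s2}" using w sS dis(1) by auto
    ultimately show ?thesis by simp
  qed
  have "distinct q \<Longrightarrow> set q \<subseteq> C \<Longrightarrow> successively (\<lambda>x y. {x, y} \<in> E) q" for q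
    using CC by (induction q rule: induct_list012) auto
  then have "successively (\<lambda>x y. {x, y} \<in> E) (c # cs)" using cs cs' by simp
  moreover have "last (c # cs) \<in> C" using cs cs' last_in_set by blast
  ultimately have suc: "successively (\<lambda>x y. {x, y} \<in> E) (c # (cs @ [s]))"
    using s(2) by (simp flip: append_Cons add: successively_append_iff del: append_Cons)
  have "leaf_tree E (insert c (A \<union> W \<union> {s1, s2}) \<union> set (cs @ [s]))
      (insert (last (c # (cs @ [s]))) (insert c {s1, s2} - {c}))"
  proof (rule leaf_tree_extend[OF 2 _ _ suc])
    show "distinct (cs @ [s])" using cs cs' s(1) dis(3) by auto
    show "set (cs @ [s]) \<inter> insert c (A \<union> W \<union> {s1, s2}) = {}"
      using cs cs' dis s(1) sS by auto
  qed auto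
  moreover have "insert c (A \<union> W \<union> {s1, s2}) \<union> set (cs @ [s]) = A \<union> W \<union> C \<union> {s, s1, s2}"
    using cs cs' by auto
  moreover have "insert (last (c # (cs @ [s]))) (insert c {s1, s2} - {c}) = {s, s1, s2}"
    using cC sS dis(3) by auto
  ultimately have 3: "leaf_tree E (A \<union> W \<union> C \<union> {s, s1, s2}) {s, s1, s2}" by simp
  have "leaf_tree E (A \<union> W \<union> C \<union> {s, s1, s2} \<union> (S - {s, s1, s2})) ({s, s1, s2} \<union> (S - {s, s1, s2}))"
  proof (rule leaf_tree_attach[OF _ 3])
    show "\<forall>r\<in>S - {s, s1, s2}. \<exists>u\<in>A \<union> W \<union> C \<union> {s, s1, s2} - {s, s1, s2}. {u, r} \<in> E"
      using w dis(1) sS s(1) by (intro ballI bexI[of _ w]) auto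
  qed (use fin dis in auto)
  moreover have "A \<union> W \<union> C \<union> {s, s1, s2} \<union> (S - {s, s1, s2}) = S \<union> W \<union> A \<union> C"
    "{s, s1, s2} \<union> (S - {s, s1, s2}) = S" using sS(1,2) s(1) by blast+
  ultimately show ?thesis by simp
qed

lemma spanning_tree_of_leaf_tree:
  assumes "leaf_tree (edges G) (verts G) S"
  shows "\<exists>T. spanning_tree T G \<and> leaves T = S"
  using assms unfolding leaf_tree_def spanning_tree_def by blast

text \<open>A vertex \<open>r \<in> R\<close> has more neighbours than there are other elements of \<open>S\<close>, hence one outside \<open>S\<close>.
That neighbour is an inner vertex of the Hamilton path.\<close>

lemma leaf_tree_of_hamilton_path:
  assumes G: "simple_graph G" and S: "S \<subseteq> verts G" "S = R \<union> {s, t}" "s \<notin> R" "t \<notin> R" "s \<noteq> t"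
    and deg: "\<And>v. v \<in> R \<Longrightarrow> card S \<le> vdegree G v"
    and p: "hamilton_path (edges G) (verts G - R) s p t"
  shows "leaf_tree (edges G) (verts G) S"
proof -
  have fin: "finite (verts G)" "finite S" using G S by (auto simp: simple_graph_def intro: finite_subset)
  have "leaf_tree (edges G) (set p) {hd p, last p}"
    by (rule leaf_tree_path) (use p S(5) in \<open>auto simp: hamilton_path_def\<close>)
  then have path: "leaf_tree (edges G) (verts G - R) {s, t}" using p by (simp add: hamilton_path_def)
  have "leaf_tree (edges G) (verts G - R \<union> R) ({s, t} \<union> R)"
  proof (rule leaf_tree_attach[OF _ path])
    show "\<forall>r\<in>R. \<exists>u\<in>verts G - R - {s, t}. {u, r} \<in> edges G"
    proof
      fix r assume r: "r \<in> R"
      let ?N = "{u \<in> verts G. {r, u} \<in> edges G}"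
      have "\<not> ?N \<subseteq> S - {r}"
      proof
        assume "?N \<subseteq> S - {r}"
        then have "card ?N \<le> card (S - {r})" using fin by (intro card_mono) auto
        also have "\<dots> < card S" using r S(2) fin by (intro card_Diff1_less) auto
        finally show False using deg[OF r] by (simp add: vdegree_def)
      qed
      then obtain u where "u \<in> ?N" "u \<notin> S - {r}" by blast
      moreover have "u \<noteq> r" using \<open>u \<in> ?N\<close> simple_graph_no_loop[OF G] by auto
      ultimately show "\<exists>u\<in>verts G - R - {s, t}. {u, r} \<in> edges G"
        using S(2) by (intro bexI[of _ u]) (auto simp: insert_commute)
    qed
  qed (use fin S in \<open>auto intro: finite_subset\<close>)
  moreover have "verts G - R \<union> R = verts G" "{s, t} \<union> R = S" using S by auto
  ultimately show ?thesis by simp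
qed

lemma split_leaf_set:
  assumes "finite S" "card S = k" "2 \<le> k" "X \<subseteq> S" "card X \<le> k - 2"
  shows "\<exists>R s t. X \<subseteq> R \<and> S = R \<union> {s, t} \<and> s \<notin> R \<and> t \<notin> R \<and> s \<noteq> t \<and> card R = k - 2"
proof -
  obtain R where R: "X \<subseteq> R" "R \<subseteq> S" "card R = k - 2"
    using exists_subset_between[OF assms(5) _ assms(4,1)] assms by auto
  then have "card (S - R) = 2" using assms by (simp add: card_Diff_subset finite_subset[OF R(2)])
  then obtain s t where "S - R = {s, t}" "s \<noteq> t" by (auto simp: card_2_iff)
  then show ?thesis using R by (intro exI[of _ R] exI[of _ s] exI[of _ t]) auto
qed

section \<open>Isomorphisms with joins and disjoint unions\<close>

text \<open>Since \<open>graph_iso\<close> only inspects pairs of vertices, the edge set need not be restricted to \<open>A\<close>. In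
this way the induced subgraphs of \<open>G\<close> are all described with the edge set of \<open>G\<close>.\<close>

abbreviation graph_on :: "'a set \<Rightarrow> 'a set set \<Rightarrow> 'a ugraph" where
  "graph_on A E \<equiv> \<lparr>verts = A, edges = E\<rparr>"

lemma Inl_pair_image: "{Inl a, Inl b} \<in> (\<lambda>e. Inl ` e) ` E \<longleftrightarrow> {a, b} \<in> E"
proof -
  have "{Inl a, Inl b} = Inl ` {a, b}" by simp
  then show ?thesis by (metis (no_types, lifting) image_iff inj_image_eq_iff inj_Inl)
qed

lemma Inr_pair_image: "{Inr a, Inr b} \<in> (\<lambda>e. Inr ` e) ` E \<longleftrightarrow> {a, b} \<in> E"
proof -
  have "{Inr a, Inr b} = Inr ` {a, b}" by simp
  then show ?thesis by (metis (no_types, lifting) image_iff inj_image_eq_iff inj_Inr)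
qed

lemma edges_disjoint_union_iff:
  "{Inl a, Inl b} \<in> edges (disjoint_union G H) \<longleftrightarrow> {a, b} \<in> edges G"
  "{Inr c, Inr d} \<in> edges (disjoint_union G H) \<longleftrightarrow> {c, d} \<in> edges H"
  "{Inl a, Inr d} \<notin> edges (disjoint_union G H)"
  "{Inr d, Inl a} \<notin> edges (disjoint_union G H)"
proof -
  have "Inl a \<notin> Inr ` e" "Inr c \<notin> Inl ` e'" for e e' and a c by auto
  then have n: "{Inl a, x} \<notin> (\<lambda>e. Inr ` e) ` E" "{x, Inl a} \<notin> (\<lambda>e. Inr ` e) ` E"
    "{Inr c, y} \<notin> (\<lambda>e. Inl ` e) ` E'" "{y, Inr c} \<notin> (\<lambda>e. Inl ` e) ` E'"
    for a c x y E E' by (metis imageE insertI1 insertI2)+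
  show "{Inl a, Inl b} \<in> edges (disjoint_union G H) \<longleftrightarrow> {a, b} \<in> edges G"
    "{Inr c, Inr d} \<in> edges (disjoint_union G H) \<longleftrightarrow> {c, d} \<in> edges H"
    "{Inl a, Inr d} \<notin> edges (disjoint_union G H)"
    "{Inr d, Inl a} \<notin> edges (disjoint_union G H)"
    by (simp_all add: disjoint_union_def Inl_pair_image Inr_pair_image n)
qed

lemma edges_graph_join_iff:
  "{Inl a, Inl b} \<in> edges (graph_join G H) \<longleftrightarrow> {a, b} \<in> edges G"
  "{Inr c, Inr d} \<in> edges (graph_join G H) \<longleftrightarrow> {c, d} \<in> edges H"
  "{Inl a, Inr d} \<in> edges (graph_join G H) \<longleftrightarrow> a \<in> verts G \<and> d \<in> verts H"
  "{Inr d, Inl a} \<in> edges (graph_join G H) \<longleftrightarrow> a \<in> verts G \<and> d \<in> verts H"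
  by (auto simp: graph_join_def edges_disjoint_union_iff doubleton_eq_iff)

lemma bij_betw_Plus:
  assumes "bij_betw f A X" "bij_betw g B Y" "A \<inter> B = {}"
  shows "bij_betw (\<lambda>v. if v \<in> A then Inl (f v) else Inr (g v)) (A \<union> B) (X <+> Y)"
  using assms unfolding bij_betw_def inj_on_def by (auto simp: Plus_def image_iff)

lemma graph_iso_disjoint_union:
  assumes A: "graph_iso (graph_on A E) H1" and B: "graph_iso (graph_on B E) H2"
    and dis: "A \<inter> B = {}" and E: "\<forall>a\<in>A. \<forall>b\<in>B. {a, b} \<notin> E"
  shows "graph_iso (graph_on (A \<union> B) E) (disjoint_union H1 H2)"
proof -
  obtain f where f: "bij_betw f A (verts H1)" "\<And>u v. u \<in> A \<Longrightarrow> v \<in> A \<Longrightarrow> {u, v} \<in> E \<longleftrightarrow> {f u, f v} \<in> edges H1"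
    using A by (auto simp: graph_iso_def)
  obtain g where g: "bij_betw g B (verts H2)" "\<And>u v. u \<in> B \<Longrightarrow> v \<in> B \<Longrightarrow> {u, v} \<in> E \<longleftrightarrow> {g u, g v} \<in> edges H2"
    using B by (auto simp: graph_iso_def)
  let ?h = "\<lambda>v. if v \<in> A then Inl (f v) else Inr (g v)"
  have bij: "bij_betw ?h (A \<union> B) (verts (disjoint_union H1 H2))"
    using bij_betw_Plus[OF f(1) g(1) dis] by (simp add: disjoint_union_def)
  have "{u, v} \<in> E \<longleftrightarrow> {?h u, ?h v} \<in> edges (disjoint_union H1 H2)"
    if uv: "u \<in> A \<union> B" "v \<in> A \<union> B" for u v
  proof -
    have AB: "x \<notin> A \<longleftrightarrow> x \<in> B" if "x \<in> A \<union> B" for x using that dis by blast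
    have E': "{a, b} \<notin> E" "{b, a} \<notin> E" if "a \<in> A" "b \<in> B" for a b
      using E that by (auto simp: insert_commute)
    show ?thesis using uv AB[OF uv(1)] AB[OF uv(2)] f(2)[of u v] g(2)[of u v] E'[of u v] E'[of v u]
      by (cases "u \<in> A"; cases "v \<in> A") (simp_all add: edges_disjoint_union_iff)
  qed
  then show ?thesis using bij unfolding graph_iso_def by auto
qed

lemma graph_iso_join:
  assumes A: "graph_iso (graph_on A E) H1" and B: "graph_iso (graph_on B E) H2"
    and dis: "A \<inter> B = {}" and E: "\<forall>a\<in>A. \<forall>b\<in>B. {a, b} \<in> E"
  shows "graph_iso (graph_on (A \<union> B) E) (graph_join H1 H2)"
proof -
  obtain f where f: "bij_betw f A (verts H1)" "\<And>u v. u \<in> A \<Longrightarrow> v \<in> A \<Longrightarrow> {u, v} \<in> E \<longleftrightarrow> {f u, f v} \<in> edges H1"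
    using A by (auto simp: graph_iso_def)
  obtain g where g: "bij_betw g B (verts H2)" "\<And>u v. u \<in> B \<Longrightarrow> v \<in> B \<Longrightarrow> {u, v} \<in> E \<longleftrightarrow> {g u, g v} \<in> edges H2"
    using B by (auto simp: graph_iso_def)
  let ?h = "\<lambda>v. if v \<in> A then Inl (f v) else Inr (g v)"
  have bij: "bij_betw ?h (A \<union> B) (verts (graph_join H1 H2))"
    using bij_betw_Plus[OF f(1) g(1) dis] by (simp add: disjoint_union_def graph_join_def)
  have "{u, v} \<in> E \<longleftrightarrow> {?h u, ?h v} \<in> edges (graph_join H1 H2)"
    if uv: "u \<in> A \<union> B" "v \<in> A \<union> B" for u v
  proof -
    have AB: "x \<notin> A \<longleftrightarrow> x \<in> B" if "x \<in> A \<union> B" for x using that dis by blast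
    have E': "{a, b} \<in> E" "{b, a} \<in> E" if "a \<in> A" "b \<in> B" for a b
      using E that by (auto simp: insert_commute)
    have fg: "a \<in> A \<Longrightarrow> f a \<in> verts H1" "b \<in> B \<Longrightarrow> g b \<in> verts H2" for a b
      using f(1) g(1) by (auto dest: bij_betwE)
    show ?thesis
      using uv AB[OF uv(1)] AB[OF uv(2)] f(2)[of u v] g(2)[of u v] E'[of u v] E'[of v u] fg(1)[of u] fg(1)[of v] fg(2)[of u] fg(2)[of v]
      by (cases "u \<in> A"; cases "v \<in> A") (simp_all add: edges_graph_join_iff)
  qed
  then show ?thesis using bij unfolding graph_iso_def by auto
qed

lemma graph_iso_complete_graph:
  assumes "finite A" "\<forall>u\<in>A. \<forall>v\<in>A. {u, v} \<in> E \<longleftrightarrow> u \<noteq> v"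
  shows "graph_iso (graph_on A E) (complete_graph (card A))"
proof -
  obtain f where f: "bij_betw f A {..<card A}"
    using ex_bij_betw_finite_nat[OF assms(1)] by (auto simp: atLeast0LessThan)
  have "{u, v} \<in> E \<longleftrightarrow> {f u, f v} \<in> edges (complete_graph (card A))" if "u \<in> A" "v \<in> A" for u v
  proof -
    have "f u \<in> {..<card A}" "f v \<in> {..<card A}" using f that by (auto dest: bij_betwE)
    moreover have "f u = f v \<longleftrightarrow> u = v" using f that by (auto simp: bij_betw_def inj_on_def)
    ultimately show ?thesis using assms(2) that by (auto simp: complete_graph_def card_insert_if)
  qed
  then show ?thesis using f unfolding graph_iso_def by (auto simp: complete_graph_def)
qed

lemma graph_iso_copies_point:
  assumes "finite A" "\<forall>u\<in>A. \<forall>v\<in>A. {u, v} \<notin> E"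
  shows "graph_iso (graph_on A E) (copies (card A) (complete_graph 1))"
proof -
  obtain f where f: "bij_betw f A {..<card A}"
    using ex_bij_betw_finite_nat[OF assms(1)] by (auto simp: atLeast0LessThan)
  have no: "e \<notin> edges (complete_graph 1)" for e
  proof
    assume "e \<in> edges (complete_graph 1)"
    then have "e \<subseteq> {0}" "card e = 2" by (auto simp: complete_graph_def)
    then show False using card_mono[of "{0}" e] by auto
  qed
  have "bij_betw (\<lambda>v. (f v, 0)) A (verts (copies (card A) (complete_graph 1)))"
    using f by (auto simp: bij_betw_def inj_on_def copies_def complete_graph_def)
  then show ?thesis
    unfolding graph_iso_def using assms(2) no by (intro exI[of _ "\<lambda>v. (f v, 0)"]) (auto simp: copies_def)
qed

lemma graph_iso_star_graph:
  assumes fin: "finite B" and z: "z \<notin> B" "{z} \<notin> E"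
    and E: "\<forall>b\<in>B. {z, b} \<in> E" "\<forall>b\<in>B. \<forall>b'\<in>B. {b, b'} \<notin> E"
  shows "graph_iso (graph_on (insert z B) E) (star_graph (card B))"
proof -
  obtain f where f: "bij_betw f B {1..card B}"
    using finite_same_card_bij[OF fin, of "{1..card B}"] by auto
  let ?h = "\<lambda>v. if v = z then 0 else f v"
  have fB: "1 \<le> f b \<and> f b \<le> card B" if "b \<in> B" for b using bij_betwE[OF f] that by auto
  have "bij_betw ?h (insert z B) (insert 0 {1..card B})"
  proof -
    have "inj_on ?h (insert z B)"
      using f fB z(1) by (auto simp: bij_betw_def inj_on_def) fastforce+
    moreover have "?h ` insert z B = insert 0 (f ` B)" using z(1) by auto
    ultimately show ?thesis using f by (simp add: bij_betw_def)
  qed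
  moreover have "insert 0 {1..card B} = verts (star_graph (card B))" by (auto simp: star_graph_def)
  ultimately have bij: "bij_betw ?h (insert z B) (verts (star_graph (card B)))" by simp
  have "{u, v} \<in> E \<longleftrightarrow> {?h u, ?h v} \<in> edges (star_graph (card B))"
    if uv: "u \<in> insert z B" "v \<in> insert z B" for u v
  proof -
    have st: "{i, j} \<in> edges (star_graph (card B)) \<longleftrightarrow>
        i = 0 \<and> 1 \<le> j \<and> j \<le> card B \<or> j = 0 \<and> 1 \<le> i \<and> i \<le> card B" for i j
      by (auto simp: star_graph_def doubleton_eq_iff)
    have E1: "{b, z} \<in> E" if "b \<in> B" for b using E(1) that by (auto simp: insert_commute)
    show ?thesis
      unfolding st using uv z E E1 fB[of u] fB[of v] by (cases "u = z"; cases "v = z") auto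
  qed
  then show ?thesis using bij unfolding graph_iso_def by auto
qed

section \<open>Graphs with large reciprocal degree distance\<close>

text \<open>Codegrees in \<open>G - R\<close> are at most those in \<open>G\<close>, so the lower bounds from \<open>chvatal_codeg\<close> carry over
to \<open>G\<close>, where the cost bound applies. The minimum degree keeps every codegree, and with it \<open>a\<close>,
at most \<open>m - 2\<close>, which means \<open>2 \<le> j\<close>.\<close>

lemma nearly_extremal_of_no_hamilton_path:
  fixes G :: "'a ugraph"
  assumes G: "simple_graph G" and n: "graph_order G = m + k" and k: "2 \<le> k" "4 \<le> m"
    and deg: "\<And>v. v \<in> verts G \<Longrightarrow> k + 1 \<le> vdegree G v"
    and cost: "(\<Sum>v\<in>verts G. cost (real (m + k) - 1) (codeg (edges G) (verts G) v))
      \<le> cost_bound (real (m + k) - 1) m"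
    and R: "R \<subseteq> verts G" "card R = k - 2"
    and st: "s \<in> verts G - R" "t \<in> verts G - R" "s \<noteq> t"
    and no: "\<nexists>p. hamilton_path (edges G) (verts G - R) s p t"
  shows "\<exists>j A M. nearly_extremal (edges G) (verts G) m j A M \<and> M \<inter> R = {}"
proof -
  let ?V = "verts G" and ?E = "edges G"
  let ?x = "codeg ?E ?V"
  have fin: "finite ?V" using G by (simp add: simple_graph_def)
  have x: "?x v \<le> m - 2" if "v \<in> ?V" for v
    using vdegree_plus_codeg[OF G that] deg[OF that] n by simp
  have finR: "finite R" using R fin finite_subset by blast
  have cR: "card (?V - R) = m + 2" using R n k by (simp add: card_Diff_subset finR)
  obtain u a A M where u: "u \<in> ?V - R" "a \<le> codeg ?E (?V - R) u" and am: "m \<le> 2 * a"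
    and AM: "A \<subseteq> M" "M \<subseteq> ?V - R" "card A = m - a" "card M = a + 1"
    and xA: "\<forall>v\<in>A. a \<le> codeg ?E (?V - R) v" and xM: "\<forall>v\<in>M. m - a \<le> codeg ?E (?V - R) v"
    using chvatal_codeg[OF _ st cR no] fin by auto
  have le: "codeg ?E (?V - R) v \<le> ?x v" for v by (rule codeg_mono[OF fin]) auto
  have a: "a \<le> m - 2" using u le[of u] x[of u] by fastforce
  define j where "j = m - a"
  have j: "2 \<le> j" "2 * j \<le> m" "m - j = a" "m + 1 - j = a + 1" using a am k by (auto simp: j_def)
  have q: "real m + 1 \<le> real (m + k) - 1" using k by simp
  have MV: "M \<subseteq> ?V" and cA: "card A = j" and cM: "card M = m + 1 - j"
    using AM j by (auto simp: j_def)
  have "m - j \<le> ?x v" if "v \<in> A" for v using xA that le[of v] j by fastforce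
  moreover have "j \<le> ?x v" if "v \<in> M" for v using xM that le[of v] by (fastforce simp: j_def)
  ultimately have "nearly_extremal ?E ?V m j A M"
    using nearly_extremal_of_cost_le[OF fin AM(1) MV cA cM j(1,2) q _ _ x cost] by blast
  then show ?thesis using AM(2) by blast
qed

text \<open>There are \<open>k + j - 1\<close> vertices outside \<open>M\<close>, of which \<open>j - 1\<close> are not in \<open>S\<close>: just one fewer than
the vertices of \<open>A\<close>, as \<open>leaf_tree_spider\<close> requires. In the second alternative the three vertices of
\<open>M - {c}\<close> play the part of \<open>A\<close> and \<open>c\<close> that of the clique; the vertex to which the branch through \<open>c\<close> is attached as well as the end of that
branch can be chosen different from \<open>z\<close>.\<close>

lemma leaf_tree_of_nearly_extremal:
  assumes G: "simple_graph G" and n: "graph_order G = m + k"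
    and S: "S \<subseteq> verts G" "card S = k" "3 \<le> k" "S \<inter> M = {}"
    and ne: "nearly_extremal (edges G) (verts G) m j A M"
  shows "leaf_tree (edges G) (verts G) S"
proof -
  have AM: "A \<subseteq> M" "M \<subseteq> verts G" "card A = j" "card M = m + 1 - j"
    and mj: "2 * j \<le> m" "j = 2 \<or> (m, j) \<in> {(6, 3), (7, 3), (8, 4)}"
    using ne unfolding nearly_extremal_def by blast+
  have j: "2 \<le> j" "2 * j \<le> m" using mj by auto
  let ?V = "verts G" and ?E = "edges G"
  let ?x = "codeg ?E ?V"
  have fin: "finite ?V" using G by (simp add: simple_graph_def)
  have finS: "finite S" "finite M" "finite A"
    using S(1) AM(1,2) fin by (meson finite_subset)+
  define W where "W = ?V - M - S"
  have "card (?V - M) = k + j - 1" using AM n j finS by (simp add: card_Diff_subset)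
  moreover have "S \<subseteq> ?V - M" using S by auto
  ultimately have cW: "card W = j - 1" unfolding W_def using S(2) finS by (simp add: card_Diff_subset)
  have finW: "finite W" using fin by (simp add: W_def)
  have V: "S \<union> W \<union> M = ?V" using S AM by (auto simp: W_def)
  have dis: "S \<inter> W = {}" "W \<inter> M = {}" by (auto simp: W_def)
  from ne consider
      "\<forall>v\<in>A. ?x v = m - j" "\<forall>v\<in>M - A. ?x v = j" "\<forall>v\<in>?V - M. ?x v = 0"
    | c z where "m = 6" "j = 3" "c \<in> M" "?x c = 4" "z \<in> ?V - M" "?x z = 1"
        "\<forall>v\<in>M - {c}. ?x v = 3" "\<forall>v\<in>?V - M - {z}. ?x v = 0"
    unfolding nearly_extremal_def by blast
  then show ?thesis
  proof cases
    case x: 1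
    note nonadj = nonadjacent_of_extremal_codeg[OF fin AM x]
    have adj: "{u, v} \<in> ?E" if "u \<in> ?V" "v \<in> ?V" "u \<noteq> v" "u \<notin> M \<or> v \<notin> M \<or> u \<notin> A \<and> v \<notin> A" for u v
      using nonadj[of u v] that by blast
    have "W \<noteq> {}" using cW j(1) by auto
    then obtain w where w: "w \<in> W" by blast
    have "S \<noteq> {}" using S(2,3) by auto
    then obtain s where s: "s \<in> S" by blast
    have cC: "card (M - A) = m + 1 - j - j" using AM finS by (simp add: card_Diff_subset)
    have "leaf_tree ?E (S \<union> W \<union> A \<union> (M - A)) S"
    proof (rule leaf_tree_spider)
      show "M - A \<noteq> {}"
      proof
        assume "M - A = {}"
        then have "m + 1 - j - j = 0" using cC card.empty by metis
        then show False using j(2) by linarith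
      qed
      show "card A = card W + 1" using cW AM j by simp
      show "\<forall>x\<in>S \<union> W. \<forall>y\<in>A. {x, y} \<in> ?E"
        using V AM(1,2) dis S(4) by (intro ballI adj) auto
      show "\<forall>c\<in>M - A. \<forall>c'\<in>M - A. c \<noteq> c' \<longrightarrow> {c, c'} \<in> ?E"
        using AM(2) by (intro ballI impI adj) auto
      show "\<forall>c\<in>M - A \<union> S. {w, c} \<in> ?E"
        using w V dis S(4) by (intro ballI adj) auto
      show "\<forall>c\<in>M - A. {c, s} \<in> ?E"
        using s V S(4) by (intro ballI adj) auto
    qed (use finS finW dis S AM s w in auto)
    moreover have "S \<union> W \<union> A \<union> (M - A) = ?V" using V AM by blast
    ultimately show ?thesis by simp
  next
    case (2 c z)
    note m = 2(1,2) and c = 2(3,4) and z = 2(5,6) and x = 2(7,8)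
    have cM: "card M = 4" using AM m by simp
    note nonadj = nonadjacent_of_pendant_codeg[OF fin AM(2) cM c z x]
    have adj: "{u, v} \<in> ?E" if "u \<in> ?V" "v \<in> M" "u \<notin> M" "u \<noteq> z \<or> v \<noteq> c" for u v
      using nonadj[of u v] that z AM by (auto simp: doubleton_eq_iff)
    have adj': "{u, v} \<in> ?E" if "u \<in> ?V" "v \<in> ?V" "u \<notin> M" "v \<notin> M" "u \<noteq> v" for u v
      using nonadj[of u v] that c by (auto simp: doubleton_eq_iff)
    have "1 \<le> card (W - {z})" using cW m finW by (simp add: card_Diff_singleton_if)
    then have "W - {z} \<noteq> {}" by (metis card.empty not_one_le_zero)
    then obtain w where w: "w \<in> W" "w \<noteq> z" by blast
    have "1 \<le> card (S - {z})" using S(2,3) finS by (auto simp: card_Diff_singleton_if)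
    then have "S - {z} \<noteq> {}" by (metis card.empty not_one_le_zero)
    then obtain s where s: "s \<in> S" "s \<noteq> z" by blast
    have "leaf_tree ?E (S \<union> W \<union> (M - {c}) \<union> {c}) S"
    proof (rule leaf_tree_spider)
      show "card (M - {c}) = card W + 1" using cW cM c m finS by simp
      show "\<forall>x\<in>S \<union> W. \<forall>y\<in>M - {c}. {x, y} \<in> ?E"
        using V dis S(4) by (intro ballI adj) auto
      have "{w, c} \<in> ?E" using w V dis(2) c(1) by (intro adj) auto
      moreover have "{w, b} \<in> ?E" if "b \<in> S" for b
        using that w V dis S(4) by (intro adj') auto
      ultimately show "\<forall>b\<in>{c} \<union> S. {w, b} \<in> ?E" by blast
      show "\<forall>b\<in>{c}. {b, s} \<in> ?E"
        using adj[of s c] s V S(4) c(1) by (auto simp: insert_commute)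
    qed (use finS finW dis S s w c in auto)
    moreover have "S \<union> W \<union> (M - {c}) \<union> {c} = ?V" using V c by blast
    ultimately show ?thesis by simp
  qed
qed

lemma graph_iso_of_nearly_extremal:
  assumes G: "simple_graph G" and n: "graph_order G = m + 2"
    and ne: "nearly_extremal (edges G) (verts G) m j A M"
  shows "graph_iso G (graph_join (complete_graph 3)
                       (disjoint_union (complete_graph (m - 3)) (copies 2 (complete_graph 1))))
    \<or> graph_iso G (graph_join (complete_graph 4) (copies 4 (complete_graph 1)))
    \<or> graph_iso G (graph_join (complete_graph 3) (disjoint_union (star_graph 3) (complete_graph 1)))
    \<or> graph_iso G (graph_join (complete_graph 4)
                    (disjoint_union (complete_graph 2) (copies 3 (complete_graph 1))))
    \<or> graph_iso G (graph_join (complete_graph 5) (copies 5 (complete_graph 1)))"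
proof -
  have AM: "A \<subseteq> M" "M \<subseteq> verts G" "card A = j" "card M = m + 1 - j"
    and mj: "2 * j \<le> m" "j = 2 \<or> (m, j) \<in> {(6, 3), (7, 3), (8, 4)}"
    using ne unfolding nearly_extremal_def by blast+
  have j: "2 \<le> j" "2 * j \<le> m" using mj by auto
  let ?V = "verts G" and ?E = "edges G"
  let ?x = "codeg ?E ?V"
  have fin: "finite ?V" using G by (simp add: simple_graph_def)
  have finM: "finite M" "finite A" using AM fin by (auto intro: finite_subset)
  have loop: "{v} \<notin> ?E" for v using simple_graph_no_loop[OF G] .
  have iso: "graph_iso G H" if "graph_iso (graph_on X ?E) H" "X = ?V" for X and H :: "'b ugraph"
    using that by (simp add: graph_iso_def)
  from ne consider
      "\<forall>v\<in>A. ?x v = m - j" "\<forall>v\<in>M - A. ?x v = j" "\<forall>v\<in>?V - M. ?x v = 0"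
    | c z where "m = 6" "j = 3" "c \<in> M" "?x c = 4" "z \<in> ?V - M" "?x z = 1"
        "\<forall>v\<in>M - {c}. ?x v = 3" "\<forall>v\<in>?V - M - {z}. ?x v = 0"
    unfolding nearly_extremal_def by blast
  then show ?thesis
  proof cases
    case x: 1
    note nonadj = nonadjacent_of_extremal_codeg[OF fin AM x]
    have edge: "{u, v} \<in> ?E \<longleftrightarrow> u \<noteq> v \<and> \<not> (u \<in> M \<and> v \<in> M \<and> (u \<in> A \<or> v \<in> A))"
      if "u \<in> ?V" "v \<in> ?V" for u v
      using nonadj[OF that] loop[of v] by (cases "u = v") auto
    have cF: "card (?V - M) = j + 1" using AM n j(2) finM by (simp add: card_Diff_subset)
    have cC: "card (M - A) = m + 1 - 2 * j" using AM finM by (simp add: card_Diff_subset)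
    have F: "graph_iso (graph_on (?V - M) ?E) (complete_graph (j + 1))"
      using graph_iso_complete_graph[of "?V - M" ?E] edge fin cF by simp
    have C: "graph_iso (graph_on (M - A) ?E) (complete_graph (m + 1 - 2 * j))"
      using graph_iso_complete_graph[of "M - A" ?E] edge finM cC AM(2) by (simp add: subset_iff)
    have I: "graph_iso (graph_on A ?E) (copies j (complete_graph 1))"
      using graph_iso_copies_point[of A ?E] edge finM AM by (auto simp: subset_iff)
    have "graph_iso (graph_on (M - A \<union> A) ?E)
        (disjoint_union (complete_graph (m + 1 - 2 * j)) (copies j (complete_graph 1)))"
      by (rule graph_iso_disjoint_union[OF C I]) (use edge AM in \<open>auto simp: subset_iff\<close>)
    moreover have "M - A \<union> A = M" using AM by auto
    ultimately have M: "graph_iso (graph_on M ?E)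
        (disjoint_union (complete_graph (m + 1 - 2 * j)) (copies j (complete_graph 1)))" by simp
    have FM: "(?V - M) \<inter> M = {}" "\<forall>a\<in>?V - M. \<forall>b\<in>M. {a, b} \<in> ?E" "?V - M \<union> M = ?V"
      using edge AM by auto
    have join: "graph_iso G (graph_join (complete_graph (j + 1))
        (disjoint_union (complete_graph (m + 1 - 2 * j)) (copies j (complete_graph 1))))"
      by (rule iso[OF graph_iso_join[OF F M FM(1,2)] FM(3)])
    \<comment> \<open>If \<open>m = 2 * j\<close>, the clique \<open>M - A\<close> is a single vertex, hence \<open>M\<close> is independent.\<close>
    have join': "graph_iso G (graph_join (complete_graph (j + 1)) (copies (j + 1) (complete_graph 1)))"
      if "m = 2 * j"
    proof -
      have "card (M - A) = 1" using cC that by simp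
      then obtain c where c: "M - A = {c}" by (auto simp: card_1_singleton_iff)
      have "{u, v} \<notin> ?E" if "u \<in> M" "v \<in> M" for u v
      proof -
        have "u \<in> A \<or> v \<in> A \<or> u = v" using that c by (metis DiffI singletonD)
        then show ?thesis using edge[of u v] that AM by auto
      qed
      then have "graph_iso (graph_on M ?E) (copies (card M) (complete_graph 1))"
        using graph_iso_copies_point[OF finM(1)] by blast
      then have "graph_iso (graph_on M ?E) (copies (j + 1) (complete_graph 1))"
        using AM(4) that by simp
      then show ?thesis by (rule iso[OF graph_iso_join[OF F _ FM(1,2)] FM(3)])
    qed
    from mj(2) consider "j = 2" | "m = 6" "j = 3" | "m = 7" "j = 3" | "m = 8" "j = 4" by auto
    then show ?thesis
    proof cases
      case 1
      then have "m + 1 - 2 * j = m - 3" "j + 1 = 3" by auto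
      then show ?thesis using join 1 by simp
    qed (use join join' in auto)
  next
    case (2 c z)
    note m = 2(1,2) and c = 2(3,4) and z = 2(5,6) and x = 2(7,8)
    have cM: "card M = 4" using AM m by simp
    note nonadj = nonadjacent_of_pendant_codeg[OF fin AM(2) cM c z x]
    have edge: "{u, v} \<in> ?E \<longleftrightarrow> u \<noteq> v \<and> \<not> (u \<in> M \<and> v \<in> M) \<and> {u, v} \<noteq> {c, z}"
      if "u \<in> ?V" "v \<in> ?V" for u v
      using nonadj[OF that] loop[of v] by (cases "u = v") auto
    define F where "F = ?V - M - {z}"
    have "card (?V - M) = 4" using AM n m finM by (simp add: card_Diff_subset)
    then have cF: "card F = 3" using z fin by (simp add: F_def)
    have "graph_iso (graph_on F ?E) (complete_graph (card F))"
      by (rule graph_iso_complete_graph) (use fin edge c in \<open>auto simp: F_def doubleton_eq_iff\<close>)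
    then have 1: "graph_iso (graph_on F ?E) (complete_graph 3)" by (simp add: cF)
    have cB: "card (M - {c}) = 3" using cM c finM by simp
    have "graph_iso (graph_on (insert z (M - {c})) ?E) (star_graph (card (M - {c})))"
      by (rule graph_iso_star_graph) (use finM z loop edge AM in \<open>auto simp: subset_iff doubleton_eq_iff\<close>)
    then have 2: "graph_iso (graph_on (insert z (M - {c})) ?E) (star_graph 3)" by (simp only: cB)
    have "graph_iso (graph_on {c} ?E) (complete_graph (card {c}))"
      by (rule graph_iso_complete_graph) (use loop in auto)
    then have 3: "graph_iso (graph_on {c} ?E) (complete_graph 1)" by simp
    have "graph_iso (graph_on (insert z (M - {c}) \<union> {c}) ?E) (disjoint_union (star_graph 3) (complete_graph 1))"
      by (rule graph_iso_disjoint_union[OF 2 3])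
        (use z c edge AM in \<open>auto simp: subset_iff doubleton_eq_iff insert_commute\<close>)
    then have "graph_iso (graph_on (F \<union> (insert z (M - {c}) \<union> {c})) ?E)
        (graph_join (complete_graph 3) (disjoint_union (star_graph 3) (complete_graph 1)))"
      by (rule graph_iso_join[OF 1]) (use z c edge AM in \<open>auto simp: F_def subset_iff doubleton_eq_iff\<close>)
    then have "graph_iso G (graph_join (complete_graph 3) (disjoint_union (star_graph 3) (complete_graph 1)))"
      by (rule iso) (use z c AM in \<open>auto simp: F_def\<close>)
    then show ?thesis by blast
  qed
qed

theorem theorem3p2:
  fixes G :: "'a ugraph" and n k :: nat
  assumes "2 \<le> k" and "k + 4 \<le> n"
    and "simple_graph G" and "connected_graph G" and "graph_order G = n"
    and "k + 1 \<le> min_degree G"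
    and "RDD G \<ge> real n ^ 3 - 7 * real n ^ 2 + (20 + 4 * real k) * real n
                  + real k ^ 2 - 4 * real k - 17"
  shows "k_leaf_connected k G
    \<or> graph_iso G (graph_join (complete_graph 3)
                              (disjoint_union (complete_graph (n - 5)) (copies 2 (complete_graph 1))))
    \<or> graph_iso G (graph_join (complete_graph 4) (copies 4 (complete_graph 1)))
    \<or> graph_iso G (graph_join (complete_graph 3) (disjoint_union (star_graph 3) (complete_graph 1)))
    \<or> graph_iso G (graph_join (complete_graph 4)
                              (disjoint_union (complete_graph 2) (copies 3 (complete_graph 1))))
    \<or> graph_iso G (graph_join (complete_graph 5) (copies 5 (complete_graph 1)))"
proof (cases "k_leaf_connected k G")
  case False
  let ?V = "verts G" and ?E = "edges G"
  let ?x = "codeg ?E ?V"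
  note k = assms(1) and G = assms(3)
  define m where "m = n - k"
  have m: "4 \<le> m" "n = m + k" "graph_order G = m + k" using assms(2,5) by (auto simp: m_def)
  have fin: "finite ?V" using G by (simp add: simple_graph_def)
  have deg: "k + 1 \<le> vdegree G v" if "v \<in> ?V" for v
  proof -
    have "min_degree G \<le> vdegree G v" unfolding min_degree_def using fin that by simp
    then show ?thesis using assms(6) by simp
  qed
  have cost: "(\<Sum>v\<in>?V. cost (real (m + k) - 1) (?x v)) \<le> cost_bound (real (m + k) - 1) m"
    using cost_le_bound_of_RDD[OF G assms(4) m(3)] assms(7) m(2) by simp
  obtain S where S: "S \<subseteq> ?V" "card S = k" and noS: "\<not> (\<exists>T. spanning_tree T G \<and> leaves T = S)"
    using False k assms(2,5) by (auto simp: k_leaf_connected_def)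
  have finS: "finite S" using S(1) fin finite_subset by blast
  have noleaf: "\<not> leaf_tree ?E ?V S" using noS spanning_tree_of_leaf_tree by blast
  have ex_near: "\<exists>j A M. nearly_extremal ?E ?V m j A M \<and> X \<inter> M = {}"
    if X: "X \<subseteq> S" "card X \<le> k - 2" for X
  proof -
    obtain R s t where R: "X \<subseteq> R" "S = R \<union> {s, t}" "s \<notin> R" "t \<notin> R" "s \<noteq> t" "card R = k - 2"
      using split_leaf_set[OF finS S(2) k X] by blast
    have "\<nexists>p. hamilton_path ?E (?V - R) s p t"
    proof
      assume "\<exists>p. hamilton_path ?E (?V - R) s p t"
      moreover have "card S \<le> vdegree G v" if "v \<in> R" for v
        using deg[of v] that S R(2) by auto
      ultimately show False using leaf_tree_of_hamilton_path[OF G S(1) R(2-5)] noleaf by blast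
    qed
    moreover have "R \<subseteq> ?V" "s \<in> ?V - R" "t \<in> ?V - R" using R(2-4) S(1) by blast+
    ultimately obtain j A M where "nearly_extremal ?E ?V m j A M" "M \<inter> R = {}"
      using nearly_extremal_of_no_hamilton_path[OF G m(3) k m(1) deg cost _ R(6) _ _ R(5)] by blast
    then show ?thesis using R(1) by blast
  qed
  obtain j A M where ne: "nearly_extremal ?E ?V m j A M" using ex_near[of "{}"] by auto
  show ?thesis
  proof (cases "k = 2")
    case True
    have "n - 5 = m - 3" using m(2) True by simp
    then show ?thesis
      using graph_iso_of_nearly_extremal[OF G _ ne] m(3) True by simp
  next
    case False
    then have k3: "3 \<le> k" using k by simp
    \<comment> \<open>If \<open>r\<close> is in both sets, there is another split of \<open>S\<close> in which \<open>r\<close> is removed and thus lies outside the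
      corresponding set \<open>M'\<close>. But codegrees are at most 1 outside \<open>M'\<close> and at least 2 in \<open>M\<close>.\<close>
    have "S \<inter> M = {}"
    proof (rule ccontr)
      assume "S \<inter> M \<noteq> {}"
      then obtain r where r: "r \<in> S" "r \<in> M" by blast
      have "{r} \<subseteq> S" "card {r} \<le> k - 2" using r(1) k3 by auto
      from ex_near[OF this] obtain j' A' M' where M': "nearly_extremal ?E ?V m j' A' M'" "r \<notin> M'" by auto
      have "?x r \<le> 1" using nearly_extremal_codeg_le[OF M'(1)] M'(2) r(1) S(1) by blast
      then show False using nearly_extremal_codeg_ge[OF ne r(2) m(1)] by simp
    qed
    then have "leaf_tree ?E ?V S"
      using leaf_tree_of_nearly_extremal[OF G m(3) S k3 _ ne] by blast
    then show ?thesis using noleaf by blast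
  qed
qed blast

end
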